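(* Let $T^-$ be the reduct of $T^+$ to the language $L^-$ (containing only the symbol $<$). Then $T^-$ is the model companion of the theory of (unlabeled) switchboards.
   Context: For a set $M$, $[M]^2$ is the set of 2-element subsets of $M$. A switchboard is a set $M$ with a strict partial order $<$ on $[M]^2$ such that for distinct $x,y,z\in M$, $\{x,y\}$ and $\{x,z\}$ are incomparable; it is an $L^-$-structure where $L^-$ has one 4-ary relation symbol $<(x,y,z,w)$ meaning $x\ne y\wedge z\ne w\wedge\{x,y\}<\{z,w\}$. A labeled switchboard is $(M,<,\uparrow,\downarrow)$ where $(M,<)$ is a switchboard, $\uparrow,\downarrow$ are binary relations between $M$ and $[M]^2$, and: (Trichotomy) for every $a\in M$, $\{b,c\}\in[M]^2$ exactly one of $a\uparrow\{b,c\}$, $a\in\{b,c\}$, $a\downarrow\{b,c\}$ holds; (Upward) $a\uparrow\{b,c\}<\{b',c'\}$ implies $a\uparrow\{b',c'\}$; (Downward) $a\downarrow\{b,c\}>\{b',c'\}$ implies $a\downarrow\{b',c'\}$. These are structures in the language $L^+\supseteq L^-$ adding 3-ary symbols $\uparrow,\downarrow$. The class of finite labeled switchboards is a Fraïssé class; $T^+$ denotes the complete theory of its Fraïssé limit (the model completion of the theory of labeled switchboards). *)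

theory Defs
  imports Complex_Main "HOL-Library.Ramsey" "HOL-Library.Countable_Set"
begin

section \<open>First-order logic over relational languages\<close>

text \<open>
  A relational language is a type of relation symbols with an arity function. Formulas use named
  variables \<open>0, 1, 2, \<dots>\<close>.
\<close>

class language =
  fixes arity :: "'a \<Rightarrow> nat"

datatype 'r fm =
    Eq nat nat
  | Rel 'r "nat list"
  | Neg "'r fm"
  | Conj "'r fm" "'r fm"
  | Exists nat "'r fm"

abbreviation Imp :: "'r fm \<Rightarrow> 'r fm \<Rightarrow> 'r fm" where
  "Imp \<phi> \<psi> \<equiv> Neg (Conj \<phi> (Neg \<psi>))"

abbreviation Forall :: "nat \<Rightarrow> 'r fm \<Rightarrow> 'r fm" where
  "Forall n \<phi> \<equiv> Neg (Exists n (Neg \<phi>))"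

primrec well_formed :: "'r::language fm \<Rightarrow> bool" where
  "well_formed (Eq m n) \<longleftrightarrow> True"
| "well_formed (Rel r ns) \<longleftrightarrow> length ns = arity r"
| "well_formed (Neg \<phi>) \<longleftrightarrow> well_formed \<phi>"
| "well_formed (Conj \<phi> \<psi>) \<longleftrightarrow> well_formed \<phi> \<and> well_formed \<psi>"
| "well_formed (Exists n \<phi>) \<longleftrightarrow> well_formed \<phi>"

primrec free_vars :: "'r fm \<Rightarrow> nat set" where
  "free_vars (Eq m n) = {m, n}"
| "free_vars (Rel r ns) = set ns"
| "free_vars (Neg \<phi>) = free_vars \<phi>"
| "free_vars (Conj \<phi> \<psi>) = free_vars \<phi> \<union> free_vars \<psi>"
| "free_vars (Exists n \<phi>) = free_vars \<phi> - {n}"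

definition sentence :: "'r::language fm \<Rightarrow> bool" where
  "sentence \<phi> \<longleftrightarrow> well_formed \<phi> \<and> free_vars \<phi> = {}"

text \<open>
  The universe of a structure is a subset of the type \<open>'a\<close>. The values of \<open>interp\<close> at lists of the
  wrong length or with entries outside the universe are junk and are never consulted.
\<close>

datatype ('r, 'a) fo_struct =
  Fo_struct (universe: "'a set") (interp: "'r \<Rightarrow> 'a list \<Rightarrow> bool")

primrec sat :: "('r, 'a) fo_struct \<Rightarrow> (nat \<Rightarrow> 'a) \<Rightarrow> 'r fm \<Rightarrow> bool" where
  "sat M v (Eq m n) \<longleftrightarrow> v m = v n"
| "sat M v (Rel r ns) \<longleftrightarrow> interp M r (map v ns)"
| "sat M v (Neg \<phi>) \<longleftrightarrow> \<not> sat M v \<phi>"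
| "sat M v (Conj \<phi> \<psi>) \<longleftrightarrow> sat M v \<phi> \<and> sat M v \<psi>"
| "sat M v (Exists n \<phi>) \<longleftrightarrow> (\<exists>a\<in>universe M. sat M (v(n := a)) \<phi>)"

definition holds :: "('r, 'a) fo_struct \<Rightarrow> 'r fm \<Rightarrow> bool" (infix "\<Turnstile>" 50) where
  "M \<Turnstile> \<phi> \<longleftrightarrow> (\<forall>v. range v \<subseteq> universe M \<longrightarrow> sat M v \<phi>)"

text \<open>Models of a theory are nonempty.\<close>

definition is_model :: "('r, 'a) fo_struct \<Rightarrow> 'r fm set \<Rightarrow> bool" where
  "is_model M T \<longleftrightarrow> universe M \<noteq> {} \<and> (\<forall>\<phi>\<in>T. M \<Turnstile> \<phi>)"

definition complete_theory :: "('r::language, 'a) fo_struct \<Rightarrow> 'r fm set" where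
  "complete_theory M = {\<phi>. sentence \<phi> \<and> M \<Turnstile> \<phi>}"

definition embedding ::
    "('a \<Rightarrow> 'b) \<Rightarrow> ('r::language, 'a) fo_struct \<Rightarrow> ('r, 'b) fo_struct \<Rightarrow> bool" where
  "embedding f A B \<longleftrightarrow>
     f ` universe A \<subseteq> universe B \<and> inj_on f (universe A) \<and>
     (\<forall>r xs. length xs = arity r \<and> set xs \<subseteq> universe A \<longrightarrow>
        (interp A r xs \<longleftrightarrow> interp B r (map f xs)))"

definition elementary_embedding ::
    "('a \<Rightarrow> 'b) \<Rightarrow> ('r::language, 'a) fo_struct \<Rightarrow> ('r, 'b) fo_struct \<Rightarrow> bool" where
  "elementary_embedding f A B \<longleftrightarrow>
     f ` universe A \<subseteq> universe B \<and>
     (\<forall>\<phi> v. well_formed \<phi> \<and> range v \<subseteq> universe A \<longrightarrow>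
        (sat A v \<phi> \<longleftrightarrow> sat B (f \<circ> v) \<phi>))"


section \<open>Model companions\<close>

text \<open>
  HOL cannot quantify over types inside a formula, so these notions are relative to a type \<open>'u\<close>
  in which all universes live. The absolute notions are obtained by
  asking for them for every infinite type \<open>'u\<close>: any two structures are isomorphic to structures on
  subsets of a common infinite type, and, for countable languages, the downward Loewenheim-Skolem
  theorem shows that an extension of a structure on a subset of an infinite \<open>'u\<close> can be chosen to
  live in \<open>'u\<close> as well.
\<close>

definition model_complete :: "'u itself \<Rightarrow> 'r::language fm set \<Rightarrow> bool" where
  "model_complete _ T \<longleftrightarrow>
     (\<forall>(A :: ('r, 'u) fo_struct) (B :: ('r, 'u) fo_struct) f.
        is_model A T \<and> is_model B T \<and> embedding f A B \<longrightarrow> elementary_embedding f A B)"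

definition models_embed :: "'u itself \<Rightarrow> 'r::language fm set \<Rightarrow> 'r fm set \<Rightarrow> bool" where
  "models_embed _ S T \<longleftrightarrow>
     (\<forall>A :: ('r, 'u) fo_struct. is_model A S \<longrightarrow>
        (\<exists>(B :: ('r, 'u) fo_struct) f. is_model B T \<and> embedding f A B))"

definition model_companion :: "'u itself \<Rightarrow> 'r::language fm set \<Rightarrow> 'r fm set \<Rightarrow> bool" where
  "model_companion U T' T \<longleftrightarrow>
     models_embed U T T' \<and> models_embed U T' T \<and> model_complete U T'"


section \<open>Fraisse limits of classes of finite relational structures\<close>

text \<open>
  A class of finite structures closed under isomorphism is represented by its members whose
  universe is a (finite) set of natural numbers.
\<close>

definition age :: "('r::language, 'a) fo_struct \<Rightarrow> ('r, nat) fo_struct set" where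
  "age M = {A. finite (universe A) \<and> (\<exists>f. embedding f A M)}"

definition automorphism :: "('a \<Rightarrow> 'a) \<Rightarrow> ('r::language, 'a) fo_struct \<Rightarrow> bool" where
  "automorphism g M \<longleftrightarrow> embedding g M M \<and> g ` universe M = universe M"

definition ultrahomogeneous :: "('r::language, 'a) fo_struct \<Rightarrow> bool" where
  "ultrahomogeneous M \<longleftrightarrow>
     (\<forall>X f. finite X \<and> X \<subseteq> universe M \<and> embedding f (Fo_struct X (interp M)) M \<longrightarrow>
        (\<exists>g. automorphism g M \<and> (\<forall>x\<in>X. g x = f x)))"

definition fraisse_limit ::
    "('r::language, nat) fo_struct set \<Rightarrow> ('r, 'a) fo_struct \<Rightarrow> bool" where
  "fraisse_limit K M \<longleftrightarrow> countable (universe M) \<and> ultrahomogeneous M \<and> age M = K"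


section \<open>Switchboards\<close>

definition switchboard :: "'a set \<Rightarrow> ('a set \<Rightarrow> 'a set \<Rightarrow> bool) \<Rightarrow> bool" where
  "switchboard M lt \<longleftrightarrow>
     irreflp_on ([M]\<^bsup>2\<^esup>) lt \<and> transp_on ([M]\<^bsup>2\<^esup>) lt \<and>
     (\<forall>x\<in>M. \<forall>y\<in>M. \<forall>z\<in>M. x \<noteq> y \<and> x \<noteq> z \<and> y \<noteq> z \<longrightarrow>
        \<not> lt {x, y} {x, z} \<and> \<not> lt {x, z} {x, y})"

definition labeled_switchboard ::
    "'a set \<Rightarrow> ('a set \<Rightarrow> 'a set \<Rightarrow> bool) \<Rightarrow> ('a \<Rightarrow> 'a set \<Rightarrow> bool) \<Rightarrow> ('a \<Rightarrow> 'a set \<Rightarrow> bool) \<Rightarrow> bool"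
  where
  "labeled_switchboard M lt up down \<longleftrightarrow>
     switchboard M lt \<and>
     (\<forall>a\<in>M. \<forall>p\<in>[M]\<^bsup>2\<^esup>.
        (up a p \<and> a \<notin> p \<and> \<not> down a p) \<or>
        (\<not> up a p \<and> a \<in> p \<and> \<not> down a p) \<or>
        (\<not> up a p \<and> a \<notin> p \<and> down a p)) \<and>
     (\<forall>a\<in>M. \<forall>p\<in>[M]\<^bsup>2\<^esup>. \<forall>q\<in>[M]\<^bsup>2\<^esup>. up a p \<and> lt p q \<longrightarrow> up a q) \<and>
     (\<forall>a\<in>M. \<forall>p\<in>[M]\<^bsup>2\<^esup>. \<forall>q\<in>[M]\<^bsup>2\<^esup>. down a p \<and> lt q p \<longrightarrow> down a q)"

datatype L_minus = Less

datatype L_plus = Base L_minus | Up | Down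

instantiation L_minus :: language
begin

primrec arity_L_minus :: "L_minus \<Rightarrow> nat" where
  "arity Less = 4"

instance ..

end

instantiation L_plus :: language
begin

primrec arity_L_plus :: "L_plus \<Rightarrow> nat" where
  "arity (Base r) = arity r"
| "arity Up = 3"
| "arity Down = 3"

instance ..

end

definition switchboard_struct :: "(L_minus, 'a) fo_struct \<Rightarrow> bool" where
  "switchboard_struct A \<longleftrightarrow>
     (\<exists>lt. switchboard (universe A) lt \<and>
        (\<forall>x\<in>universe A. \<forall>y\<in>universe A. \<forall>z\<in>universe A. \<forall>w\<in>universe A.
           interp A Less [x, y, z, w] \<longleftrightarrow> x \<noteq> y \<and> z \<noteq> w \<and> lt {x, y} {z, w}))"

definition labeled_switchboard_struct :: "(L_plus, 'a) fo_struct \<Rightarrow> bool" where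
  "labeled_switchboard_struct A \<longleftrightarrow>
     (\<exists>lt up down. labeled_switchboard (universe A) lt up down \<and>
        (\<forall>x\<in>universe A. \<forall>y\<in>universe A. \<forall>z\<in>universe A. \<forall>w\<in>universe A.
           interp A (Base Less) [x, y, z, w] \<longleftrightarrow> x \<noteq> y \<and> z \<noteq> w \<and> lt {x, y} {z, w}) \<and>
        (\<forall>a\<in>universe A. \<forall>b\<in>universe A. \<forall>c\<in>universe A.
           (interp A Up [a, b, c] \<longleftrightarrow> b \<noteq> c \<and> up a {b, c}) \<and>
           (interp A Down [a, b, c] \<longleftrightarrow> b \<noteq> c \<and> down a {b, c})))"

definition finite_labeled_switchboards :: "(L_plus, nat) fo_struct set" where
  "finite_labeled_switchboards = {A. finite (universe A) \<and> labeled_switchboard_struct A}"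

text \<open>
  The first axiom says that \<open>Less\<close> comes from a relation on unordered pairs. The remaining three
  are irreflexivity, transitivity and the incomparability of pairs sharing a point.
\<close>

definition switchboard_theory :: "L_minus fm set" where
  "switchboard_theory =
     (let lt = (\<lambda>x y z w. Rel Less [x, y, z, w]) in
      {Forall 0 (Forall 1 (Forall 2 (Forall 3
         (Imp (lt 0 1 2 3)
           (Conj (Conj (Neg (Eq 0 1)) (Neg (Eq 2 3))) (Conj (lt 1 0 2 3) (lt 0 1 3 2))))))),
       Forall 0 (Forall 1 (Neg (lt 0 1 0 1))),
       Forall 0 (Forall 1 (Forall 2 (Forall 3 (Forall 4 (Forall 5
         (Imp (Conj (lt 0 1 2 3) (lt 2 3 4 5)) (lt 0 1 4 5))))))),
       Forall 0 (Forall 1 (Forall 2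
         (Imp (Conj (Neg (Eq 0 1)) (Conj (Neg (Eq 0 2)) (Neg (Eq 1 2))))
           (Conj (Neg (lt 0 1 0 2)) (Neg (lt 0 2 0 1))))))})"

lemma sentence_switchboard_theory: "\<phi> \<in> switchboard_theory \<Longrightarrow> sentence \<phi>"
  by (auto simp: switchboard_theory_def Let_def sentence_def)

lemma sat_Forall: "sat M v (Forall n \<phi>) \<longleftrightarrow> (\<forall>a\<in>universe M. sat M (v(n := a)) \<phi>)"
  by simp

lemma sat_Imp: "sat M v (Imp \<phi> \<psi>) \<longleftrightarrow> (sat M v \<phi> \<longrightarrow> sat M v \<psi>)"
  by simp

lemma is_model_switchboard_theory_iff:
  "is_model A switchboard_theory \<longleftrightarrow> universe A \<noteq> {} \<and> switchboard_struct A"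
proof (cases "universe A = {}")
  case True
  then show ?thesis by (simp add: is_model_def)
next
  case False
  define R where "R x y z w \<longleftrightarrow> interp A Less [x, y, z, w]" for x y z w
  let ?U = "universe A"
  have ex: "\<exists>v::nat \<Rightarrow> 'a. range v \<subseteq> ?U"
    using False by (auto intro!: exI[of _ "\<lambda>_. SOME a. a \<in> ?U"] some_in_eq[THEN iffD2])
  have axioms: "is_model A switchboard_theory \<longleftrightarrow>
    (\<forall>x\<in>?U. \<forall>y\<in>?U. \<forall>z\<in>?U. \<forall>w\<in>?U. R x y z w \<longrightarrow>
       x \<noteq> y \<and> z \<noteq> w \<and> R y x z w \<and> R x y w z) \<and>
    (\<forall>x\<in>?U. \<forall>y\<in>?U. \<not> R x y x y) \<and>
    (\<forall>x\<in>?U. \<forall>y\<in>?U. \<forall>z\<in>?U. \<forall>w\<in>?U. \<forall>u\<in>?U. \<forall>v\<in>?U. R x y z w \<and> R z w u v \<longrightarrow> R x y u v) \<and>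
    (\<forall>x\<in>?U. \<forall>y\<in>?U. \<forall>z\<in>?U. x \<noteq> y \<and> x \<noteq> z \<and> y \<noteq> z \<longrightarrow> \<not> R x y x z \<and> \<not> R x z x y)"
    (is "_ \<longleftrightarrow> ?ax")
  proof -
    have holdsI: "A \<Turnstile> \<phi> \<longleftrightarrow> P" if "\<And>v. sat A v \<phi> \<longleftrightarrow> P" for \<phi> P
      unfolding holds_def that using ex by blast
    have split: "is_model A {a, b, c, d} \<longleftrightarrow> P \<and> Q \<and> S \<and> T"
      if "A \<Turnstile> a \<longleftrightarrow> P" "A \<Turnstile> b \<longleftrightarrow> Q" "A \<Turnstile> c \<longleftrightarrow> S" "A \<Turnstile> d \<longleftrightarrow> T" for a b c d P Q S T
      using False that by (simp add: is_model_def)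
    show ?thesis
      unfolding switchboard_theory_def Let_def
    proof (intro split holdsI)
    qed (simp_all only: sat_Forall sat_Imp,
        simp_all only: sat.simps list.map R_def fun_upd_apply if_True if_False simp_thms
          zero_neq_one one_neq_zero zero_neq_numeral numeral_neq_zero one_eq_numeral_iff
          numeral_eq_one_iff numeral_eq_iff num.simps conj_assoc)
  qed
  have "?ax \<longleftrightarrow> switchboard_struct A"
  proof
    assume ax: ?ax
    have neq: "x \<noteq> y" "z \<noteq> w" and swap: "R y x z w" "R x y w z"
      if "R x y z w" "x \<in> ?U" "y \<in> ?U" "z \<in> ?U" "w \<in> ?U" for x y z w
      using ax[THEN conjunct1, rule_format, OF that(2-5,1)] by iprover+
    have irr: "\<not> R x y x y" if "x \<in> ?U" "y \<in> ?U" for x y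
      using ax[THEN conjunct2, THEN conjunct1] that by simp
    have tr: "R x y u v" if "R x y z w" "R z w u v"
      "x \<in> ?U" "y \<in> ?U" "z \<in> ?U" "w \<in> ?U" "u \<in> ?U" "v \<in> ?U" for x y z w u v
      using ax[THEN conjunct2, THEN conjunct2, THEN conjunct1, rule_format, of x y z w u v] that
      by iprover
    have inc: "\<not> R x y x z \<and> \<not> R x z x y"
      if "x \<in> ?U" "y \<in> ?U" "z \<in> ?U" "x \<noteq> y" "x \<noteq> z" "y \<noteq> z" for x y z
      using ax[THEN conjunct2, THEN conjunct2, THEN conjunct2, rule_format, of x y z] that by simp
    define lt where "lt p q \<longleftrightarrow>
      (\<exists>x\<in>?U. \<exists>y\<in>?U. \<exists>z\<in>?U. \<exists>w\<in>?U. p = {x, y} \<and> q = {z, w} \<and> R x y z w)" for p q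
    have lt: "lt {x, y} {z, w} \<longleftrightarrow> R x y z w"
      if U: "x \<in> ?U" "y \<in> ?U" "z \<in> ?U" "w \<in> ?U" for x y z w
    proof
      assume "lt {x, y} {z, w}"
      then obtain x' y' z' w' where
        "{x, y} = {x', y'}" "{z, w} = {z', w'}" and R': "R x' y' z' w'"
        and U': "x' \<in> ?U" "y' \<in> ?U" "z' \<in> ?U" "w' \<in> ?U"
        unfolding lt_def by blast
      then have "x = x' \<and> y = y' \<or> x = y' \<and> y = x'" "z = z' \<and> w = w' \<or> z = w' \<and> w = z'"
        by (simp_all add: doubleton_eq_iff)
      moreover have "R y' x' z' w'" "R x' y' w' z'" "R y' x' w' z'"
        using swap[OF R' U'] swap[OF swap(1)[OF R' U']] U' by simp_all
      ultimately show "R x y z w" using R' by auto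
    next
      assume "R x y z w"
      then show "lt {x, y} {z, w}" unfolding lt_def using U by blast
    qed
    have "irreflp_on ([?U]\<^bsup>2\<^esup>) lt"
      by (auto simp: irreflp_on_def nsets_2_eq lt irr)
    moreover have "transp_on ([?U]\<^bsup>2\<^esup>) lt"
      unfolding transp_on_def nsets_2_eq by (auto simp: lt intro: tr)
    moreover have "\<forall>x\<in>?U. \<forall>y\<in>?U. \<forall>z\<in>?U. x \<noteq> y \<and> x \<noteq> z \<and> y \<noteq> z \<longrightarrow>
        \<not> lt {x, y} {x, z} \<and> \<not> lt {x, z} {x, y}"
      using inc by (simp add: lt)
    ultimately have "switchboard ?U lt"
      by (simp add: switchboard_def)
    moreover have "interp A Less [x, y, z, w] \<longleftrightarrow> x \<noteq> y \<and> z \<noteq> w \<and> lt {x, y} {z, w}"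
      if "x \<in> ?U" "y \<in> ?U" "z \<in> ?U" "w \<in> ?U" for x y z w
      using lt[OF that] neq[OF _ that] by (auto simp: R_def)
    ultimately show "switchboard_struct A"
      unfolding switchboard_struct_def by blast
  next
    assume "switchboard_struct A"
    then obtain lt where sb: "switchboard ?U lt"
      and interp: "\<forall>x\<in>?U. \<forall>y\<in>?U. \<forall>z\<in>?U. \<forall>w\<in>?U.
        interp A Less [x, y, z, w] \<longleftrightarrow> x \<noteq> y \<and> z \<noteq> w \<and> lt {x, y} {z, w}"
      unfolding switchboard_struct_def by (elim exE conjE)
    have R: "R x y z w \<longleftrightarrow> x \<noteq> y \<and> z \<noteq> w \<and> lt {x, y} {z, w}"
      if "x \<in> ?U" "y \<in> ?U" "z \<in> ?U" "w \<in> ?U" for x y z w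
      unfolding R_def by (rule interp[rule_format, OF that])
    have ir: "irreflp_on ([?U]\<^bsup>2\<^esup>) lt" and tp: "transp_on ([?U]\<^bsup>2\<^esup>) lt"
      using sb by (simp_all only: switchboard_def)
    have irr: "\<not> lt {x, y} {x, y}" if "x \<in> ?U" "y \<in> ?U" "x \<noteq> y" for x y
      using irreflp_onD[OF ir] that by (meson doubleton_in_nsets_2)
    have tr: "lt {x, y} {u, v}"
      if "lt {x, y} {z, w}" "lt {z, w} {u, v}" "x \<in> ?U" "y \<in> ?U" "z \<in> ?U" "w \<in> ?U" "u \<in> ?U" "v \<in> ?U"
        "x \<noteq> y" "z \<noteq> w" "u \<noteq> v" for x y z w u v
      by (rule transp_onD[OF tp _ _ _ that(1,2)]) (use that in simp_all)
    have inc: "\<not> lt {x, y} {x, z} \<and> \<not> lt {x, z} {x, y}"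
      if "x \<in> ?U" "y \<in> ?U" "z \<in> ?U" "x \<noteq> y" "x \<noteq> z" "y \<noteq> z" for x y z
      using sb[unfolded switchboard_def, THEN conjunct2, THEN conjunct2, rule_format, of x y z] that
      by iprover
    show ?ax
    proof (intro conjI ballI impI)
      fix x y z w assume "x \<in> ?U" "y \<in> ?U" "z \<in> ?U" "w \<in> ?U" "R x y z w"
      then show "x \<noteq> y" "z \<noteq> w" "R y x z w" "R x y w z"
        by (auto simp: R insert_commute)
    next
      fix x y z w u v
      assume U: "x \<in> ?U" "y \<in> ?U" "z \<in> ?U" "w \<in> ?U" "u \<in> ?U" "v \<in> ?U"
        and "R x y z w \<and> R z w u v"
      then show "R x y u v" using tr[of x y z w u v] by (simp add: R)
    qed (use irr inc in \<open>auto simp: R\<close>)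
  qed
  then show ?thesis using axioms False by simp
qed


definition reduct_to_L_minus :: "L_plus fm set \<Rightarrow> L_minus fm set" where
  "reduct_to_L_minus T = {\<phi>. map_fm Base \<phi> \<in> T}"

end

theory Submission
  imports Defs "HOL-Library.Countable_Set_Type"
begin

text \<open>
  In the Fraisse limit \<open>M\<close>, \<open>a \<down> {b, c}\<close> holds iff some pair \<open>{a, d}\<close> lies above \<open>{b, c}\<close>, and dually
  for \<open>\<up>\<close>: such a pair forces the label by trichotomy, and conversely a fourth point \<open>d\<close> can be added
  to \<open>{a, b, c}\<close>. By trichotomy the labels and their negations are then existentially definable from
  \<open><\<close>. Ultrahomogeneity makes the truth of a formula at a tuple depend only on the atomic labeled
  type of the tuple, so over \<open>M\<close> every formula in \<open><\<close> is equivalent to an existential one in \<open><\<close>, and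
  the theory of the reduct is model complete. Conversely, every switchboard has a labeling, with
  \<open>a \<down> p\<close> iff some \<open>{a, d}\<close> lies above \<open>p\<close>, so its finite subsets embed in \<open>M\<close>. It therefore embeds
  in an ultrapower of the reduct, which the downward Loewenheim-Skolem theorem cuts down to
  the required size.
\<close>

text \<open>The age of \<open>M\<close> speaks only of finite substructures, so no relations
  \<open>lt\<close>, \<open>up\<close>, \<open>down\<close> on all of \<open>M\<close> are at hand:
  each fact about \<open>M\<close> is read off from a finite set containing the points concerned.
  The point \<open>d\<close> is added in an abstract four-point structure, which embeds into
  \<open>M\<close> over some copy of \<open>{a, b, c}\<close>; ultrahomogeneity moves this copy back
  onto \<open>a\<close>, \<open>b\<close>, \<open>c\<close>. The abstract structure is easy to build
  because two pairs inside three points always meet: the comparison with the new pair is the only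
  one present, and transitivity is vacuous. Existential definitions of both labels are what makes
  negations harmless, as the negation of one label is the other label or a coincidence among the
  points. Ultrahomogeneity is available for \<open>M\<close> and not for its reduct, so types are
  taken in the labeled language; it is finite, so a tuple has finitely many possible atomic types
  and their disjunction is a single formula. Size is the obstacle in the embedding part: the
  ultrapower lives on a function type, and only a hull of bounded cardinality can be copied into the
  prescribed type \<open>'u\<close>.\<close>

unbundle cardinal_syntax

section \<open>Satisfaction, embeddings and existential formulas\<close>

instance L_minus :: countable
  by countable_datatype

text \<open>Countability of the set of formulas keeps the hull in
  \<open>downward_Loewenheim_Skolem\<close> small.\<close>

instance fm :: (countable) countable
  by countable_datatype

lemma finite_free_vars: "finite (free_vars \<phi>)"
  by (induction \<phi>) auto

lemma sat_cong:
  assumes "\<And>n. n \<in> free_vars \<phi> \<Longrightarrow> v n = w n"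
  shows "sat M v \<phi> \<longleftrightarrow> sat M w \<phi>"
  using assms
proof (induction \<phi> arbitrary: v w)
  case (Rel r ns)
  then have "map v ns = map w ns" by simp
  then show ?case by (simp del: map_eq_conv)
next
  case (Conj \<phi> \<psi>)
  have "sat M v \<phi> \<longleftrightarrow> sat M w \<phi>" by (rule Conj.IH(1)) (use Conj.prems in auto)
  moreover have "sat M v \<psi> \<longleftrightarrow> sat M w \<psi>" by (rule Conj.IH(2)) (use Conj.prems in auto)
  ultimately show ?case by simp
next
  case (Exists n \<phi>)
  have "sat M (v(n := a)) \<phi> \<longleftrightarrow> sat M (w(n := a)) \<phi>" for a
    by (rule Exists.IH) (use Exists.prems in auto)
  then show ?case by simp
next
  case (Neg \<phi>)
  have "sat M v \<phi> \<longleftrightarrow> sat M w \<phi>" by (rule Neg.IH) (use Neg.prems in auto)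
  then show ?case by simp
qed auto

lemma range_fun_upd_subset: "range v \<subseteq> U \<Longrightarrow> a \<in> U \<Longrightarrow> range (v(n := a)) \<subseteq> U"
  by auto

abbreviation reduct :: "(L_plus, 'a) fo_struct \<Rightarrow> (L_minus, 'a) fo_struct" where
  "reduct M \<equiv> Fo_struct (universe M) (\<lambda>r. interp M (Base r))"

lemma sat_map_fm_Base: "sat M v (map_fm Base \<phi>) \<longleftrightarrow> sat (reduct M) v \<phi>"
  by (induction \<phi> arbitrary: v) auto

lemma well_formed_map_fm_Base: "well_formed (map_fm Base \<phi>) \<longleftrightarrow> well_formed \<phi>"
  by (induction \<phi>) auto

lemma sentence_map_fm_Base: "sentence (map_fm Base \<phi>) \<longleftrightarrow> sentence \<phi>"
proof -
  have "free_vars (map_fm Base \<phi>) = free_vars \<phi>" by (induction \<phi>) auto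
  then show ?thesis by (simp add: sentence_def well_formed_map_fm_Base)
qed

lemma reduct_complete_theory:
  "reduct_to_L_minus (complete_theory M) = complete_theory (reduct M)"
  by (simp add: reduct_to_L_minus_def complete_theory_def sentence_map_fm_Base holds_def
      sat_map_fm_Base)

text \<open>The relation \<open>\<Turnstile>\<close> already quantifies over all assignments, so
  universal closure changes nothing.\<close>

lemma holds_foldr_Forall: "A \<Turnstile> foldr Forall xs \<phi> \<longleftrightarrow> A \<Turnstile> \<phi>"
proof (induction xs)
  case (Cons n xs)
  have "A \<Turnstile> Forall n \<psi> \<longleftrightarrow> A \<Turnstile> \<psi>" for \<psi>
  proof
    assume L: "A \<Turnstile> Forall n \<psi>"
    show "A \<Turnstile> \<psi>"
      unfolding holds_def
    proof (intro allI impI)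
      fix v :: "nat \<Rightarrow> 'b" assume v: "range v \<subseteq> universe A"
      then have "v n \<in> universe A" by auto
      with L v have "sat A (v(n := v n)) \<psi>" unfolding holds_def sat_Forall by blast
      then show "sat A v \<psi>" by simp
    qed
  next
    assume "A \<Turnstile> \<psi>"
    then show "A \<Turnstile> Forall n \<psi>"
      unfolding holds_def sat_Forall by (metis range_fun_upd_subset)
  qed
  with Cons show ?case by simp
qed simp

text \<open>A complete theory contains sentences only; a formula with free variables is transferred
  through its universal closure.\<close>

lemma complete_theory_holds:
  assumes "is_model A (complete_theory N)" "N \<Turnstile> \<phi>" "well_formed \<phi>"
  shows "A \<Turnstile> \<phi>"
proof -
  obtain xs where xs: "set xs = free_vars \<phi>"
    using finite_list finite_free_vars by metis
  have "free_vars (foldr Forall ys \<phi>) = free_vars \<phi> - set ys" for ys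
    by (induction ys) auto
  moreover have "well_formed (foldr Forall ys \<phi>)" for ys
    by (induction ys) (use assms in auto)
  ultimately have "foldr Forall xs \<phi> \<in> complete_theory N"
    using assms xs by (simp add: complete_theory_def sentence_def holds_foldr_Forall)
  then show ?thesis
    using assms(1) unfolding is_model_def by (metis holds_foldr_Forall)
qed

section \<open>Existential formulas and a criterion for model completeness\<close>

abbreviation Disj :: "'r fm \<Rightarrow> 'r fm \<Rightarrow> 'r fm" where
  "Disj \<phi> \<psi> \<equiv> Neg (Conj (Neg \<phi>) (Neg \<psi>))"

text \<open>Negation is allowed on atoms only. As \<open>Disj\<close> unfolds to a negation, closure
  under disjunction takes a rule of its own.\<close>

inductive existential :: "'r::language fm \<Rightarrow> bool" where
  "existential (Eq m n)"
| "existential (Neg (Eq m n))"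
| "length ns = arity r \<Longrightarrow> existential (Rel r ns)"
| "length ns = arity r \<Longrightarrow> existential (Neg (Rel r ns))"
| "existential \<phi> \<Longrightarrow> existential \<psi> \<Longrightarrow> existential (Conj \<phi> \<psi>)"
| "existential \<phi> \<Longrightarrow> existential \<psi> \<Longrightarrow> existential (Disj \<phi> \<psi>)"
| "existential \<phi> \<Longrightarrow> existential (Exists n \<phi>)"

lemma well_formed_existential: "existential \<phi> \<Longrightarrow> well_formed \<phi>"
  by (induction rule: existential.induct) auto

lemma embedding_interp:
  assumes "embedding f A B" "length ns = arity r" "range v \<subseteq> universe A"
  shows "interp A r (map v ns) \<longleftrightarrow> interp B r (map (f \<circ> v) ns)"
proof -
  have "length (map v ns) = arity r" "set (map v ns) \<subseteq> universe A" using assms by auto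
  then have "interp A r (map v ns) \<longleftrightarrow> interp B r (map f (map v ns))"
    using assms(1) unfolding embedding_def by blast
  then show ?thesis by simp
qed

lemma embedding_eq_iff:
  assumes "embedding f A B" "range v \<subseteq> universe A"
  shows "f (v m) = f (v n) \<longleftrightarrow> v m = v n"
  using assms inj_on_eq_iff[of f "universe A" "v m" "v n"] unfolding embedding_def by blast

text \<open>Embeddings both preserve and reflect atoms, which settles negated atoms; a witness
  \<open>a\<close> of a quantifier is carried to \<open>f a\<close>.\<close>

lemma existential_embedding:
  assumes "existential \<phi>" and f: "embedding f A B"
    and "range v \<subseteq> universe A" "sat A v \<phi>"
  shows "sat B (f \<circ> v) \<phi>"
  using assms(1,3,4)
proof (induction arbitrary: v rule: existential.induct)
  case (7 \<phi> n)
  then obtain a where a: "a \<in> universe A" "sat A (v(n := a)) \<phi>" by auto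
  then have "sat B (f \<circ> v(n := a)) \<phi>" using 7 range_fun_upd_subset by metis
  then have "sat B ((f \<circ> v)(n := f a)) \<phi>" by (simp add: fun_upd_comp del: o_apply)
  moreover have "f a \<in> universe B" using f a unfolding embedding_def by blast
  ultimately show ?case unfolding sat.simps by blast
next
  case (1 m n)
  then show ?case by simp
next
  case (2 m n)
  then show ?case using embedding_eq_iff[OF f, of v m n] by simp
next
  case (3 ns r)
  then show ?case using embedding_interp[OF f, of ns r v] by (simp add: comp_def)
next
  case (4 ns r)
  then show ?case using embedding_interp[OF f, of ns r v] by (simp add: comp_def)
qed auto

text \<open>An equivalence of \<open>\<phi>\<close> with an existential \<open>\<psi>\<close> is
  true in \<open>N\<close>, hence in every model of its theory, so truth of \<open>\<phi>\<close>
  passes up along embeddings. Applied to \<open>Neg \<phi>\<close>, the same argument passes it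
  down.\<close>

lemma model_complete_complete_theory:
  fixes N :: "('r::language, 'a) fo_struct"
  assumes ex: "\<And>\<phi>. well_formed \<phi> \<Longrightarrow>
      \<exists>\<psi>. existential \<psi> \<and> (\<forall>v. range v \<subseteq> universe N \<longrightarrow> sat N v \<phi> = sat N v \<psi>)"
  shows "model_complete TYPE('u) (complete_theory N)"
  unfolding model_complete_def
proof (intro allI impI, elim conjE)
  fix A B :: "('r, 'u) fo_struct" and f
  assume A: "is_model A (complete_theory N)" and B: "is_model B (complete_theory N)"
    and f: "embedding f A B"
  have up: "sat B (f \<circ> v) \<phi>"
    if \<phi>: "well_formed \<phi>" and v: "range v \<subseteq> universe A" and sat: "sat A v \<phi>" for \<phi> v
  proof -
    obtain \<psi> where \<psi>: "existential \<psi>"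
      and eq: "\<forall>v. range v \<subseteq> universe N \<longrightarrow> sat N v \<phi> = sat N v \<psi>"
      using ex[OF \<phi>] by blast
    let ?i = "Conj (Imp \<phi> \<psi>) (Imp \<psi> \<phi>)"
    have "N \<Turnstile> ?i" "well_formed ?i"
      using eq \<phi> well_formed_existential[OF \<psi>] by (auto simp: holds_def)
    then have iff: "A \<Turnstile> ?i" "B \<Turnstile> ?i"
      using complete_theory_holds A B by blast+
    have "sat A v \<psi>" using iff(1) v sat by (auto simp: holds_def)
    then have "sat B (f \<circ> v) \<psi>" using existential_embedding \<psi> f v by blast
    moreover have "range (f \<circ> v) \<subseteq> universe B" using f v unfolding embedding_def by auto
    ultimately show ?thesis using iff(2) by (auto simp: holds_def)
  qed
  show "elementary_embedding f A B"
    unfolding elementary_embedding_def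
  proof (intro conjI allI impI)
    show "f ` universe A \<subseteq> universe B" using f by (simp add: embedding_def)
    fix \<phi> :: "'r fm" and v :: "nat \<Rightarrow> 'u" assume "well_formed \<phi> \<and> range v \<subseteq> universe A"
    then show "sat A v \<phi> \<longleftrightarrow> sat B (f \<circ> v) \<phi>"
      using up[of \<phi> v] up[of "Neg \<phi>" v] by auto
  qed
qed

text \<open>The quantifier step uses surjectivity of \<open>g\<close> to pull witnesses
  back.\<close>

lemma sat_automorphism:
  assumes g: "automorphism g M" and "well_formed \<phi>" "range v \<subseteq> universe M"
  shows "sat M v \<phi> \<longleftrightarrow> sat M (g \<circ> v) \<phi>"
  using assms(2,3)
proof (induction \<phi> arbitrary: v)
  case (Exists n \<phi>)
  have "sat M (v(n := a)) \<phi> \<longleftrightarrow> sat M ((g \<circ> v)(n := g a)) \<phi>" if "a \<in> universe M" for a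
  proof -
    have "sat M (v(n := a)) \<phi> \<longleftrightarrow> sat M (g \<circ> v(n := a)) \<phi>"
      by (rule Exists.IH) (use Exists.prems that in auto)
    moreover have "g \<circ> v(n := a) = (g \<circ> v)(n := g a)" by auto
    ultimately show ?thesis by simp
  qed
  moreover have "universe M = g ` universe M" using g by (simp add: automorphism_def)
  ultimately show ?case by (metis (no_types, lifting) image_iff sat.simps(5))
next
  case (Eq m n)
  then show ?case using g embedding_eq_iff[of g M M v m n] by (simp add: automorphism_def)
next
  case (Rel r ns)
  then show ?case using g embedding_interp[of g M M ns r v] by (simp add: automorphism_def comp_def)
qed simp_all

section \<open>Existentially definable predicates on assignments\<close>

text \<open>The predicate is semantic, so that truth of a labeled formula in \<open>M\<close> can be
  called definable in the reduct, whose language lacks the labels.\<close>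

definition existentially_definable ::
    "('r::language, 'a) fo_struct \<Rightarrow> ((nat \<Rightarrow> 'a) \<Rightarrow> bool) \<Rightarrow> bool" where
  "existentially_definable N P \<longleftrightarrow>
     (\<exists>\<psi>. existential \<psi> \<and> (\<forall>v. range v \<subseteq> universe N \<longrightarrow> P v = sat N v \<psi>))"

lemma existentially_definable_sat:
  "existential \<psi> \<Longrightarrow> existentially_definable N (\<lambda>v. sat N v \<psi>)"
  unfolding existentially_definable_def by blast

lemma existentially_definable_cong:
  assumes "existentially_definable N P" "\<And>v. range v \<subseteq> universe N \<Longrightarrow> P v = Q v"
  shows "existentially_definable N Q"
  using assms unfolding existentially_definable_def by simp

lemma existentially_definable_conj:
  assumes "existentially_definable N P" "existentially_definable N Q"
  shows "existentially_definable N (\<lambda>v. P v \<and> Q v)"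
proof -
  obtain \<phi> \<psi> where "existential \<phi>" "\<forall>v. range v \<subseteq> universe N \<longrightarrow> P v = sat N v \<phi>"
    "existential \<psi>" "\<forall>v. range v \<subseteq> universe N \<longrightarrow> Q v = sat N v \<psi>"
    using assms unfolding existentially_definable_def by blast
  then show ?thesis
    unfolding existentially_definable_def
    by (intro exI[of _ "Conj \<phi> \<psi>"]) (simp add: existential.intros)
qed

lemma existentially_definable_disj:
  assumes "existentially_definable N P" "existentially_definable N Q"
  shows "existentially_definable N (\<lambda>v. P v \<or> Q v)"
proof -
  obtain \<phi> \<psi> where "existential \<phi>" "\<forall>v. range v \<subseteq> universe N \<longrightarrow> P v = sat N v \<phi>"
    "existential \<psi>" "\<forall>v. range v \<subseteq> universe N \<longrightarrow> Q v = sat N v \<psi>"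
    using assms unfolding existentially_definable_def by blast
  then show ?thesis
    unfolding existentially_definable_def
    by (intro exI[of _ "Disj \<phi> \<psi>"]) (simp add: existential.intros)
qed

text \<open>The syntax has no truth constants: \<open>Eq 0 0\<close> serves as the empty
  conjunction, and below \<open>Neg (Eq 0 0)\<close> as the empty disjunction.\<close>

lemma existentially_definable_finite_ball:
  assumes "finite I" "\<And>i. i \<in> I \<Longrightarrow> existentially_definable N (P i)"
  shows "existentially_definable N (\<lambda>v. \<forall>i\<in>I. P i v)"
  using assms
proof (induction I)
  case empty
  show ?case
    by (rule existentially_definable_cong[OF existentially_definable_sat[of "Eq 0 0"]])
      (auto intro: existential.intros)
next
  case (insert i I)
  then have "existentially_definable N (\<lambda>v. P i v \<and> (\<forall>i\<in>I. P i v))"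
    by (intro existentially_definable_conj) auto
  then show ?case by (rule existentially_definable_cong) auto
qed

lemma existentially_definable_finite_bex:
  assumes "finite I" "\<And>i. i \<in> I \<Longrightarrow> existentially_definable N (P i)"
  shows "existentially_definable N (\<lambda>v. \<exists>i\<in>I. P i v)"
  using assms
proof (induction I)
  case empty
  show ?case
    by (rule existentially_definable_cong[OF existentially_definable_sat[of "Neg (Eq 0 0)"]])
      (auto intro: existential.intros)
next
  case (insert i I)
  then have "existentially_definable N (\<lambda>v. P i v \<or> (\<exists>i\<in>I. P i v))"
    by (intro existentially_definable_disj) auto
  then show ?case by (rule existentially_definable_cong) auto
qed

text \<open>\<open>Q\<close> depends only on the set of \<open>i\<close> with \<open>P i v\<close>.
  It is therefore the disjunction, over the finitely many such sets realised by assignments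
  satisfying \<open>Q\<close>, of the conjunction that says which \<open>P i\<close> hold and which
  fail.\<close>

lemma existentially_definable_finite_types:
  fixes N :: "('r::language, 'a) fo_struct"
  assumes I: "finite I"
    and pos: "\<And>i. i \<in> I \<Longrightarrow> existentially_definable N (P i)"
    and neg: "\<And>i. i \<in> I \<Longrightarrow> existentially_definable N (\<lambda>v. \<not> P i v)"
    and Q: "\<And>v w. range v \<subseteq> universe N \<Longrightarrow> range w \<subseteq> universe N \<Longrightarrow>
      (\<And>i. i \<in> I \<Longrightarrow> P i v = P i w) \<Longrightarrow> Q v = Q w"
  shows "existentially_definable N Q"
proof -
  define \<T> where "\<T> = {{i\<in>I. P i w} | w. range w \<subseteq> universe N \<and> Q w}"
  have "\<T> \<subseteq> Pow I" by (auto simp: \<T>_def)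
  then have "finite \<T>" using I by (meson finite_Pow_iff finite_subset)
  then have "existentially_definable N
      (\<lambda>v. \<exists>S\<in>\<T>. (\<forall>i\<in>S. P i v) \<and> (\<forall>i\<in>I - S. \<not> P i v))"
    using I \<open>\<T> \<subseteq> Pow I\<close> pos neg
    by (intro existentially_definable_finite_bex existentially_definable_conj
        existentially_definable_finite_ball) (auto intro: finite_subset)
  then show ?thesis
  proof (rule existentially_definable_cong)
    fix v :: "nat \<Rightarrow> 'a" assume v: "range v \<subseteq> universe N"
    show "(\<exists>S\<in>\<T>. (\<forall>i\<in>S. P i v) \<and> (\<forall>i\<in>I - S. \<not> P i v)) = Q v"
    proof
      assume "\<exists>S\<in>\<T>. (\<forall>i\<in>S. P i v) \<and> (\<forall>i\<in>I - S. \<not> P i v)"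
      then obtain w where w: "range w \<subseteq> universe N" "Q w"
        and "\<And>i. i \<in> I \<Longrightarrow> P i v = P i w" unfolding \<T>_def by blast
      then show "Q v" using Q v by blast
    next
      assume "Q v"
      then have "{i\<in>I. P i v} \<in> \<T>" using v unfolding \<T>_def by blast
      then show "\<exists>S\<in>\<T>. (\<forall>i\<in>S. P i v) \<and> (\<forall>i\<in>I - S. \<not> P i v)" by (rule rev_bexI) auto
    qed
  qed
qed

section \<open>Quantifier elimination from ultrahomogeneity\<close>

text \<open>Equations belong to the type of a tuple: they make the map between two tuples of the
  same type well defined and injective. The length condition keeps the set finite over a finite
  language.\<close>

definition atoms :: "nat set \<Rightarrow> 'r::language fm set" where
  "atoms V = (\<lambda>(m, n). Eq m n) ` (V \<times> V) \<union>
     (\<Union>r. Rel r ` {ns. set ns \<subseteq> V \<and> length ns = arity r})"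

lemma finite_atoms:
  assumes "finite V" "finite (UNIV :: 'r::language set)"
  shows "finite (atoms V :: 'r fm set)"
  unfolding atoms_def using assms by (auto intro: finite_lists_length_eq)

text \<open>Two tuples of the same atomic type are matched by an embedding of a finite substructure;
  it extends to an automorphism, which preserves all formulas.\<close>

lemma ultrahomogeneous_sat_cong:
  fixes M :: "('r::language, 'a) fo_struct"
  assumes M: "ultrahomogeneous M" and \<phi>: "well_formed \<phi>"
    and v: "range v \<subseteq> universe M" and w: "range w \<subseteq> universe M"
    and eq: "\<And>\<theta>. \<theta> \<in> atoms (free_vars \<phi>) \<Longrightarrow> sat M v \<theta> = sat M w \<theta>"
  shows "sat M v \<phi> \<longleftrightarrow> sat M w \<phi>"
proof -
  let ?V = "free_vars \<phi>"
  have Eq: "v m = v n \<longleftrightarrow> w m = w n" if "m \<in> ?V" "n \<in> ?V" for m n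
    using eq[of "Eq m n"] that by (force simp: atoms_def)
  \<comment> \<open>\<open>inv_into\<close> picks some index at which \<open>v\<close> takes the
    value \<open>x\<close>; since \<open>v\<close> and \<open>w\<close> satisfy the same equations,
    the value of \<open>w\<close> there does not depend on the choice.\<close>
  define f where "f = (\<lambda>x. w (inv_into ?V v x))"
  have f: "f (v n) = w n" if "n \<in> ?V" for n
    using Eq[of "inv_into ?V v (v n)" n] that unfolding f_def
    by (simp add: f_inv_into_f inv_into_into)
  have "embedding f (Fo_struct (v ` ?V) (interp M)) M"
    unfolding embedding_def
  proof (intro conjI allI impI)
    show "f ` universe (Fo_struct (v ` ?V) (interp M)) \<subseteq> universe M"
      using f w by auto
    show "inj_on f (universe (Fo_struct (v ` ?V) (interp M)))"
      using f Eq by (auto simp: inj_on_def)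
    fix r :: 'r and xs
    assume xs: "length xs = arity r \<and> set xs \<subseteq> universe (Fo_struct (v ` ?V) (interp M))"
    then have "xs \<in> lists (v ` ?V)" by auto
    then obtain ns where ns: "xs = map v ns" "set ns \<subseteq> ?V"
      by (auto simp: lists_image)
    then have "Rel r ns \<in> atoms ?V" using xs by (auto simp: atoms_def)
    moreover have "map f xs = map w ns" using ns f by auto
    ultimately show "interp (Fo_struct (v ` ?V) (interp M)) r xs = interp M r (map f xs)"
      using eq[of "Rel r ns"] by (simp add: ns(1) del: map_map map_eq_conv)
  qed
  moreover have "finite (v ` ?V)" "v ` ?V \<subseteq> universe M"
    using v by (auto simp: finite_free_vars)
  ultimately obtain g where g: "automorphism g M" "\<forall>x\<in>v ` ?V. g x = f x"
    using M unfolding ultrahomogeneous_def by blast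
  have "sat M v \<phi> \<longleftrightarrow> sat M (g \<circ> v) \<phi>" using sat_automorphism g(1) \<phi> v by blast
  also have "\<dots> \<longleftrightarrow> sat M w \<phi>" by (rule sat_cong) (use g f in auto)
  finally show ?thesis .
qed

section \<open>Models from finite substructures\<close>

text \<open>A minimal proper filter below \<open>F0\<close> is an ultrafilter. Zorn's lemma is
  applied to the reversed order, with the improper filter \<open>bot\<close> excluded.\<close>

lemma ultrafilter_exists:
  assumes "F0 \<noteq> bot"
  obtains F where "F \<le> F0" "F \<noteq> bot"
    "\<And>P. eventually (\<lambda>x. \<not> P x) F \<longleftrightarrow> \<not> eventually P F"
proof -
  let ?A = "{F. F \<le> F0 \<and> F \<noteq> bot}"
  have "\<exists>m\<in>?A. \<forall>a\<in>?A. a \<le> m \<longrightarrow> a = m"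
  proof (rule predicate_Zorn)
    show "partial_order_on ?A (relation_of (\<lambda>x y. y \<le> x) ?A)"
      by (auto simp: partial_order_on_def preorder_on_def refl_on_def trans_def antisym_def
          relation_of_def)
    fix C assume C: "C \<in> Chains (relation_of (\<lambda>x y. y \<le> x) ?A)"
    then have sub: "C \<subseteq> ?A" and ch: "\<And>x y. x \<in> C \<Longrightarrow> y \<in> C \<Longrightarrow> x \<le> y \<or> y \<le> x"
      by (auto simp: Chains_def relation_of_def)
    show "\<exists>u\<in>?A. \<forall>a\<in>C. u \<le> a"
    proof (cases "C = {}")
      case False
      \<comment> \<open>On a chain, whatever the infimum makes eventually true is already so in some
        member; hence the infimum stays proper.\<close>
      have "eventually P (Inf C) \<longleftrightarrow> (\<exists>b\<in>C. eventually P b)" for P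
        using False by (rule eventually_Inf_base) (metis ch inf.absorb1 inf.absorb2 order_refl)
      then have "Inf C \<noteq> bot"
        using sub by (auto simp: trivial_limit_def)
      moreover have "Inf C \<le> F0"
        using False sub by (metis (no_types, lifting) Inf_lower2 ex_in_conv mem_Collect_eq subsetD)
      ultimately show ?thesis by (auto intro: Inf_lower)
    qed (use assms in auto)
  qed
  then obtain F where F: "F \<le> F0" "F \<noteq> bot" and min: "\<And>G. G \<le> F0 \<Longrightarrow> G \<noteq> bot \<Longrightarrow> G \<le> F \<Longrightarrow> G = F"
    by auto
  have "eventually (\<lambda>x. \<not> P x) F \<longleftrightarrow> \<not> eventually P F" for P
  proof
    assume "eventually (\<lambda>x. \<not> P x) F"
    then show "\<not> eventually P F"
      using F(2) eventually_conj[of P F "\<lambda>x. \<not> P x"] by (auto simp: trivial_limit_def)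
  next
    assume n: "\<not> eventually P F"
    \<comment> \<open>As \<open>P\<close> is not eventually true, adding its complement yields a
      proper filter below \<open>F\<close>, which minimality identifies with
      \<open>F\<close>.\<close>
    have "inf F (principal {x. \<not> P x}) = F"
    proof (rule min)
      show "inf F (principal {x. \<not> P x}) \<noteq> bot"
        using n by (simp add: trivial_limit_def eventually_inf_principal)
    qed (use F in \<open>auto intro: le_infI1\<close>)
    moreover have "eventually (\<lambda>x. \<not> P x) (inf F (principal {x. \<not> P x}))"
      by (simp add: eventually_inf_principal)
    ultimately show "eventually (\<lambda>x. \<not> P x) F" by simp
  qed
  then show thesis using that F by blast
qed

text \<open>
  Elements of the ultrapower are represented by chosen representatives of the classes of functions
  that agree almost everywhere.
\<close>

definition ultrapower ::
    "'i filter \<Rightarrow> ('r::language, 'a) fo_struct \<Rightarrow> ('r, 'i \<Rightarrow> 'a) fo_struct" where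
  "ultrapower F N = Fo_struct
     ((\<lambda>h. SOME k. range k \<subseteq> universe N \<and> eventually (\<lambda>i. k i = h i) F) ` {h. range h \<subseteq> universe N})
     (\<lambda>r xs. eventually (\<lambda>i. interp N r (map (\<lambda>x. x i) xs)) F)"

lemma ultrapower_range:
  assumes "h \<in> universe (ultrapower F N)"
  shows "range h \<subseteq> universe N"
proof -
  obtain h' where h': "range h' \<subseteq> universe N"
    and h: "h = (SOME k. range k \<subseteq> universe N \<and> eventually (\<lambda>i. k i = h' i) F)"
    using assms by (auto simp: ultrapower_def)
  show ?thesis unfolding h by (rule someI2[of _ h']) (use h' in auto)
qed

lemma ultrapower_representative:
  assumes "range h \<subseteq> universe N"
  obtains k where "k \<in> universe (ultrapower F N)" "eventually (\<lambda>i. k i = h i) F"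
proof -
  let ?P = "\<lambda>k. range k \<subseteq> universe N \<and> eventually (\<lambda>i. k i = h i) F"
  have "?P (SOME k. ?P k)" by (rule someI[of _ h]) (use assms in auto)
  moreover have "(SOME k. ?P k) \<in> universe (ultrapower F N)"
    using assms by (auto simp: ultrapower_def)
  ultimately show thesis using that by blast
qed

lemma ultrapower_eqI:
  assumes "h \<in> universe (ultrapower F N)" "k \<in> universe (ultrapower F N)"
    "eventually (\<lambda>i. h i = k i) F"
  shows "h = k"
proof -
  obtain h' where h': "range h' \<subseteq> universe N"
    and h: "h = (SOME k. range k \<subseteq> universe N \<and> eventually (\<lambda>i. k i = h' i) F)"
    using assms by (auto simp: ultrapower_def)
  obtain k' where k': "range k' \<subseteq> universe N"
    and k: "k = (SOME l. range l \<subseteq> universe N \<and> eventually (\<lambda>i. l i = k' i) F)"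
    using assms by (auto simp: ultrapower_def)
  have "eventually (\<lambda>i. h i = h' i) F"
    unfolding h by (rule someI2[of _ h']) (use h' in auto)
  moreover have "eventually (\<lambda>i. k i = k' i) F"
    unfolding k by (rule someI2[of _ k']) (use k' in auto)
  ultimately have "eventually (\<lambda>i. h' i = k' i) F"
    using assms(3) by eventually_elim simp
  \<comment> \<open>The two representatives are chosen by equivalent predicates, so
    \<open>SOME\<close> returns the same function.\<close>
  then have "eventually (\<lambda>i. l i = h' i) F \<longleftrightarrow> eventually (\<lambda>i. l i = k' i) F" for l
    by (auto elim: eventually_elim2)
  then show ?thesis by (simp add: h k)
qed

text \<open>The hypothesis on \<open>F\<close> gives the negation step; the existential step glues
  pointwise witnesses into one function.\<close>

theorem Los:
  assumes F: "\<And>P. eventually (\<lambda>x. \<not> P x) F \<longleftrightarrow> \<not> eventually P F"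
    and "range v \<subseteq> universe (ultrapower F N)"
  shows "sat (ultrapower F N) v \<phi> \<longleftrightarrow> eventually (\<lambda>i. sat N (\<lambda>n. v n i) \<phi>) F"
  using assms(2)
proof (induction \<phi> arbitrary: v)
  case (Eq m n)
  then show ?case using ultrapower_eqI[of "v m" F N "v n"] by auto
next
  case (Rel r ns)
  then show ?case by (simp add: ultrapower_def comp_def)
next
  case (Neg \<phi>)
  then show ?case by (simp add: F)
next
  case (Conj \<phi> \<psi>)
  then show ?case by (simp add: eventually_conj_iff)
next
  case (Exists n \<phi>)
  let ?U = "ultrapower F N"
  have upd: "sat ?U (v(n := h)) \<phi> \<longleftrightarrow> eventually (\<lambda>i. sat N ((\<lambda>n. v n i)(n := h i)) \<phi>) F"
    if "h \<in> universe ?U" for h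
  proof -
    have "(\<lambda>m. (v(n := h)) m i) = (\<lambda>n. v n i)(n := h i)" for i by auto
    moreover have "sat ?U (v(n := h)) \<phi> \<longleftrightarrow> eventually (\<lambda>i. sat N (\<lambda>m. (v(n := h)) m i) \<phi>) F"
      by (rule Exists.IH) (use Exists.prems that in auto)
    ultimately show ?thesis by (simp only:)
  qed
  show ?case
  proof
    assume "sat ?U v (Exists n \<phi>)"
    then obtain h where h: "h \<in> universe ?U" "sat ?U (v(n := h)) \<phi>" by auto
    then have "eventually (\<lambda>i. sat N ((\<lambda>n. v n i)(n := h i)) \<phi>) F" using upd by simp
    then show "eventually (\<lambda>i. sat N (\<lambda>n. v n i) (Exists n \<phi>)) F"
      by (rule eventually_mono) (use ultrapower_range[OF h(1)] in auto)
  next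
    assume ev: "eventually (\<lambda>i. sat N (\<lambda>n. v n i) (Exists n \<phi>)) F"
    \<comment> \<open>At indices without a witness the value is \<open>v 0 i\<close>, which at least
      lies in \<open>universe N\<close>; by \<open>ev\<close> these indices are negligible.\<close>
    define h where "h = (\<lambda>i. if sat N (\<lambda>n. v n i) (Exists n \<phi>)
      then SOME a. a \<in> universe N \<and> sat N ((\<lambda>n. v n i)(n := a)) \<phi> else v 0 i)"
    have wit: "h i \<in> universe N \<and> sat N ((\<lambda>n. v n i)(n := h i)) \<phi>"
      if "sat N (\<lambda>n. v n i) (Exists n \<phi>)" for i
    proof -
      have "\<exists>a. a \<in> universe N \<and> sat N ((\<lambda>n. v n i)(n := a)) \<phi>" using that by auto
      then have "(SOME a. a \<in> universe N \<and> sat N ((\<lambda>n. v n i)(n := a)) \<phi>) \<in> universe N \<and>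
          sat N ((\<lambda>n. v n i)(n := (SOME a. a \<in> universe N \<and> sat N ((\<lambda>n. v n i)(n := a)) \<phi>))) \<phi>"
        by (rule someI_ex)
      then show ?thesis using that by (simp add: h_def)
    qed
    have v0: "v 0 i \<in> universe N" for i
      using Exists.prems ultrapower_range[of "v 0" F N] by auto
    have "range h \<subseteq> universe N"
    proof safe
      fix i show "h i \<in> universe N"
        using wit[of i] v0[of i] by (cases "sat N (\<lambda>n. v n i) (Exists n \<phi>)") (auto simp: h_def)
    qed
    \<comment> \<open>The glued \<open>h\<close> need not be a chosen representative, so it is
      exchanged for an almost equal one.\<close>
    then obtain k where k: "k \<in> universe ?U" "eventually (\<lambda>i. k i = h i) F"
      by (rule ultrapower_representative)
    from k(2) ev have "eventually (\<lambda>i. sat N ((\<lambda>n. v n i)(n := k i)) \<phi>) F"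
      by eventually_elim (use wit in simp)
    then show "sat ?U v (Exists n \<phi>)" using upd[OF k(1)] k(1) by auto
  qed
qed

lemma ultrapower_sentence:
  assumes F: "\<And>P. eventually (\<lambda>x. \<not> P x) F \<longleftrightarrow> \<not> eventually P F"
    and "N \<Turnstile> \<phi>"
  shows "ultrapower F N \<Turnstile> \<phi>"
  unfolding holds_def
proof (intro allI impI)
  fix v :: "nat \<Rightarrow> _" assume v: "range v \<subseteq> universe (ultrapower F N)"
  have "v n i \<in> universe N" for n i
    using v ultrapower_range[of "v n" F N] by auto
  then have "range (\<lambda>n. v n i) \<subseteq> universe N" for i by (auto simp: image_subset_iff)
  then have "sat N (\<lambda>n. v n i) \<phi>" for i
    using assms(2) by (simp add: holds_def)
  then show "sat (ultrapower F N) v \<phi>" using Los[OF F v] by simp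
qed

text \<open>The indices are sets of points, and \<open>a\<close> is sent to the class of the
  function taking \<open>X\<close> to \<open>f X a\<close>. The ultrafilter refines the filter of
  finite subsets, so a given finite list of points lies in almost every \<open>X\<close>, where
  \<open>f X\<close> respects its atoms.\<close>

lemma embedding_ultrapower:
  fixes A :: "('r::language, 'b) fo_struct" and N :: "('r, 'a) fo_struct"
  assumes ne: "universe N \<noteq> {}"
    and emb: "\<And>X. finite X \<Longrightarrow> X \<subseteq> universe A \<Longrightarrow> \<exists>f. embedding f (Fo_struct X (interp A)) N"
  obtains F :: "'b set filter" and \<iota> where
    "\<And>P. eventually (\<lambda>x. \<not> P x) F \<longleftrightarrow> \<not> eventually P F" "embedding \<iota> A (ultrapower F N)"
proof -
  obtain F :: "'b set filter" where le: "F \<le> finite_subsets_at_top (universe A)"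
    and F_ne: "F \<noteq> bot"
    and ultra: "\<And>P. eventually (\<lambda>x. \<not> P x) F \<longleftrightarrow> \<not> eventually P F"
    by (rule ultrafilter_exists[OF finite_subsets_at_top_neq_bot[of "universe A"]]) blast
  have "\<forall>X. \<exists>f. finite X \<longrightarrow> X \<subseteq> universe A \<longrightarrow> embedding f (Fo_struct X (interp A)) N"
    using emb by blast
  from choice[OF this]
  have "\<exists>f. \<forall>X. finite X \<longrightarrow> X \<subseteq> universe A \<longrightarrow> embedding (f X) (Fo_struct X (interp A)) N" .
  then obtain f where f: "\<And>X. finite X \<Longrightarrow> X \<subseteq> universe A \<Longrightarrow>
    embedding (f X) (Fo_struct X (interp A)) N" by blast
  have ev: "eventually (\<lambda>X. embedding (f X) (Fo_struct X (interp A)) N \<and> Y \<subseteq> X) F"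
    if "finite Y" "Y \<subseteq> universe A" for Y
  proof (rule filter_leD[OF le])
    show "eventually (\<lambda>X. embedding (f X) (Fo_struct X (interp A)) N \<and> Y \<subseteq> X)
        (finite_subsets_at_top (universe A))"
      unfolding eventually_finite_subsets_at_top
      by (intro exI[of _ Y]) (simp add: that f)
  qed
  \<comment> \<open>The value used at indices \<open>X\<close> where \<open>f X a\<close> falls
    outside \<open>universe N\<close>, as may happen when \<open>a\<close> is not in
    \<open>X\<close>.\<close>
  obtain d where d: "d \<in> universe N" using ne by auto
  have "\<forall>a. \<exists>k. k \<in> universe (ultrapower F N) \<and>
      eventually (\<lambda>X. k X = (if f X a \<in> universe N then f X a else d)) F"
  proof
    fix a
    have "range (\<lambda>X. if f X a \<in> universe N then f X a else d) \<subseteq> universe N" using d by auto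
    then show "\<exists>k. k \<in> universe (ultrapower F N) \<and>
        eventually (\<lambda>X. k X = (if f X a \<in> universe N then f X a else d)) F" by (rule ultrapower_representative) blast
  qed
  from choice[OF this] obtain \<iota>
    where \<iota>: "\<And>a. \<iota> a \<in> universe (ultrapower F N)"
    and \<iota>_ev: "\<And>a. eventually (\<lambda>X. \<iota> a X = (if f X a \<in> universe N then f X a else d)) F"
    by blast
  have \<iota>_f: "eventually (\<lambda>X. \<iota> a X = f X a) F" if "a \<in> universe A" for a
  proof -
    have "eventually (\<lambda>X. embedding (f X) (Fo_struct X (interp A)) N \<and> {a} \<subseteq> X) F"
      using ev[of "{a}"] that by simp
    with \<iota>_ev[of a] show ?thesis
      by eventually_elim (auto simp: embedding_def split: if_splits)
  qed
  have "embedding \<iota> A (ultrapower F N)"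
    unfolding embedding_def
  proof (intro conjI allI impI)
    show "\<iota> ` universe A \<subseteq> universe (ultrapower F N)" using \<iota> by auto
    show "inj_on \<iota> (universe A)"
    proof (rule inj_onI)
      fix a b assume ab: "a \<in> universe A" "b \<in> universe A" "\<iota> a = \<iota> b"
      have "eventually (\<lambda>X. embedding (f X) (Fo_struct X (interp A)) N \<and> {a, b} \<subseteq> X) F"
        using ev[of "{a, b}"] ab by simp
      with \<iota>_f[OF ab(1)] \<iota>_f[OF ab(2)] have "eventually (\<lambda>X. a = b) F"
        by eventually_elim (use ab(3) in \<open>auto simp: embedding_def inj_on_def\<close>)
      \<comment> \<open>The statement does not depend on the index, so in a proper filter it is true
        once it is eventually true.\<close>
      then show "a = b" unfolding eventually_const[OF F_ne] .
    qed
    fix r :: 'r and xs assume xs: "length xs = arity r \<and> set xs \<subseteq> universe A"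
    have "eventually (\<lambda>X. embedding (f X) (Fo_struct X (interp A)) N \<and> set xs \<subseteq> X) F"
      using ev[of "set xs"] xs by simp
    moreover have "eventually (\<lambda>X. \<forall>a\<in>set xs. \<iota> a X = f X a) F"
      using xs \<iota>_f by (simp add: eventually_ball_finite_distrib subset_iff)
    ultimately have iff: "eventually (\<lambda>X. interp N r (map (\<lambda>x. x X) (map \<iota> xs)) = interp A r xs) F"
    proof eventually_elim
      fix X assume e: "embedding (f X) (Fo_struct X (interp A)) N \<and> set xs \<subseteq> X"
        and "\<forall>a\<in>set xs. \<iota> a X = f X a"
      then have "map (\<lambda>x. x X) (map \<iota> xs) = map (f X) xs" by simp
      moreover have "interp A r xs = interp N r (map (f X) xs)"
        using e xs unfolding embedding_def by simp
      ultimately show "interp N r (map (\<lambda>x. x X) (map \<iota> xs)) = interp A r xs" by (simp only:)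
    qed
    have "eventually (\<lambda>X. interp N r (map (\<lambda>x. x X) (map \<iota> xs))) F \<longleftrightarrow> eventually (\<lambda>X. interp A r xs) F"
      using iff by (intro eventually_subst)
    also have "\<dots> \<longleftrightarrow> interp A r xs" by (rule eventually_const[OF F_ne])
    finally show "interp A r xs = interp (ultrapower F N) r (map \<iota> xs)"
      by (simp add: ultrapower_def comp_def)
  qed
  then show thesis by (rule that[OF ultra])
qed

section \<open>Elementary substructures of bounded cardinality\<close>

lemma card_of_lists_ordLeq_infinite:
  assumes "infinite B" "|A| \<le>o |B|"
  shows "|lists A| \<le>o |B|"
proof -
  have length_le: "|{xs. set xs \<subseteq> A \<and> length xs = n}| \<le>o |B|" for n
  proof (induction n)
    case 0
    have "{xs. set xs \<subseteq> A \<and> length xs = 0} = {[]}" by auto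
    then show ?case using assms(1) card_of_singl_ordLeq[of B "[] :: 'b list"] by auto
  next
    case (Suc n)
    let ?L = "{xs. set xs \<subseteq> A \<and> length xs = n}"
    have eq: "{xs. set xs \<subseteq> A \<and> length xs = Suc n} = (\<lambda>(x, xs). x # xs) ` (A \<times> ?L)"
      by (auto simp: length_Suc_conv image_iff)
    have times_le: "|A \<times> ?L| \<le>o |B|"
      using assms Suc by (intro card_of_Times_ordLeq_infinite_Field) (auto simp: card_of_card_order_on Field_card_of)
    show ?case unfolding eq by (rule ordLeq_transitive[OF card_of_image times_le])
  qed
  have "|UNIV :: nat set| \<le>o |B|" using assms(1) unfolding infinite_iff_card_of_nat .
  then have "|\<Union>n::nat. {xs. set xs \<subseteq> A \<and> length xs = n}| \<le>o |B|"
    using length_le by (intro card_of_UNION_ordLeq_infinite[OF assms(1)] ballI)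
  moreover have "lists A = (\<Union>n::nat. {xs. set xs \<subseteq> A \<and> length xs = n})" by auto
  ultimately show ?thesis by simp
qed

text \<open>\<open>S\<close> is a Skolem hull, and \<open>closed\<close> is the Tarski-Vaught
  criterion for it. Countably many formulas and finite parameter lists add at most
  \<open>|UNIV :: 'u set|\<close> points per stage. A finite list with entries in \<open>S\<close>
  lies in a single stage, so the union over all natural numbers is closed.\<close>

theorem downward_Loewenheim_Skolem:
  fixes U :: "('r::{language, countable}, 'b) fo_struct"
  assumes inf: "infinite (UNIV :: 'u set)"
    and S0: "S0 \<subseteq> universe U" "|S0| \<le>o |UNIV :: 'u set|"
  obtains S where "S0 \<subseteq> S" "S \<subseteq> universe U" "|S| \<le>o |UNIV :: 'u set|"
    "\<And>v \<phi>. range v \<subseteq> S \<Longrightarrow> sat (Fo_struct S (interp U)) v \<phi> \<longleftrightarrow> sat U v \<phi>"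
proof -
  let ?u = "|UNIV :: 'u set|"
  \<comment> \<open>A triple \<open>(\<phi>, n, xs)\<close> asks for a value of variable
    \<open>n\<close> making \<open>\<phi>\<close> true when every other variable \<open>i\<close> is
    read as \<open>xs ! i\<close>. \<open>W\<close> chooses an answer, and \<open>D S\<close>
    collects the answerable requests with parameters in \<open>S\<close>.\<close>
  define W where "W = (\<lambda>(\<phi>, n, xs). SOME a. a \<in> universe U \<and> sat U (((!) xs)(n := a)) \<phi>)"
  define D where "D S = {(\<phi>, n, xs) | \<phi> n xs.
    xs \<in> lists S \<and> (\<exists>a. a \<in> universe U \<and> sat U (((!) xs)(n := a)) \<phi>)}" for S
  define T where "T = rec_nat S0 (\<lambda>_ S. S \<union> W ` D S)"
  have T_0: "T 0 = S0" and T_Suc: "T (Suc k) = T k \<union> W ` D (T k)" for k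
    by (simp_all add: T_def)
  have W: "W (\<phi>, n, xs) \<in> universe U \<and> sat U (((!) xs)(n := W (\<phi>, n, xs))) \<phi>"
    if "\<exists>a. a \<in> universe U \<and> sat U (((!) xs)(n := a)) \<phi>" for \<phi> n xs
    unfolding W_def prod.case by (rule someI_ex[OF that])
  have T_U: "T k \<subseteq> universe U" for k
  proof (induction k)
    case (Suc k)
    have "W ` D (T k) \<subseteq> universe U" unfolding D_def using W by blast
    with Suc show ?case by (simp add: T_Suc)
  qed (simp add: T_0 S0)
  have countable_le: "|A| \<le>o ?u" if "countable A" for A :: "'c set"
    using that inf by (meson countable_card_le_natLeq infinite_iff_natLeq_ordLeq ordLeq_transitive)
  have times_le: "|A \<times> B| \<le>o ?u" if "|A| \<le>o ?u" "|B| \<le>o ?u" for A :: "'c set" and B :: "'d set"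
    using that inf by (intro card_of_Times_ordLeq_infinite_Field) (auto simp: card_of_card_order_on Field_card_of)
  have T_card: "|T k| \<le>o ?u" for k
  proof (induction k)
    case (Suc k)
    have "|(UNIV :: 'r fm set) \<times> (UNIV :: nat set) \<times> lists (T k)| \<le>o ?u"
      by (intro times_le[OF countable_le times_le[OF countable_le]]
          card_of_lists_ordLeq_infinite inf Suc) auto
    moreover have "D (T k) \<subseteq> UNIV \<times> UNIV \<times> lists (T k)" by (auto simp: D_def)
    ultimately have "|W ` D (T k)| \<le>o ?u"
      by (meson card_of_image card_of_mono1 ordLeq_transitive)
    with Suc inf show ?case
      unfolding T_Suc by (intro card_of_Un_ordLeq_infinite_Field) (auto simp: card_of_card_order_on Field_card_of)
  qed (simp add: T_0 S0)
  define S where "S = (\<Union>k. T k)"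
  have mono: "T j \<subseteq> T k" if "j \<le> k" for j k
    by (rule lift_Suc_mono_le[OF _ that]) (auto simp: T_Suc)
  have lists: "\<exists>k. xs \<in> lists (T k)" if "xs \<in> lists S" for xs
    using that
  proof (induction xs)
    case (Cons x xs)
    then obtain j k where "x \<in> T j" "xs \<in> lists (T k)" by (auto simp: S_def)
    then have "x # xs \<in> lists (T (max j k))"
      using mono[of j "max j k"] mono[of k "max j k"] by auto
    then show ?case by blast
  qed (simp_all)
  have closed: "\<exists>b\<in>S. sat U (v(n := b)) \<phi>"
    if v: "range v \<subseteq> S" and a: "a \<in> universe U" "sat U (v(n := a)) \<phi>" for v n a \<phi>
  proof -
    have "\<exists>m. \<forall>i\<in>free_vars \<phi>. i < m"
      using finite_free_vars[of \<phi>] by (simp add: finite_nat_set_iff_bounded)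
    then obtain m where m: "\<And>i. i \<in> free_vars \<phi> \<Longrightarrow> i < m" by blast
    \<comment> \<open>The list reaches past all free variables of \<open>\<phi>\<close>, so the
      unspecified values of \<open>(!) xs\<close> beyond its end do not affect truth.\<close>
    define xs where "xs = map v [0..<m]"
    have cong: "sat U (((!) xs)(n := b)) \<phi> \<longleftrightarrow> sat U (v(n := b)) \<phi>" for b
      by (rule sat_cong) (auto simp: xs_def dest: m)
    have "xs \<in> lists S" using v by (auto simp: xs_def image_subset_iff)
    then obtain k where "xs \<in> lists (T k)" using lists by blast
    moreover have ex: "\<exists>a. a \<in> universe U \<and> sat U (((!) xs)(n := a)) \<phi>" using a cong by blast
    ultimately have "W (\<phi>, n, xs) \<in> T (Suc k)" by (auto simp: T_Suc D_def)
    then show ?thesis using W[OF ex] cong by (auto simp: S_def)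
  qed
  have S_U: "S \<subseteq> universe U" using T_U by (auto simp: S_def)
  have "sat (Fo_struct S (interp U)) v \<phi> \<longleftrightarrow> sat U v \<phi>" if "range v \<subseteq> S" for v \<phi>
    using that
  proof (induction \<phi> arbitrary: v)
    case (Exists n \<phi>)
    have IH: "sat (Fo_struct S (interp U)) (v(n := b)) \<phi> \<longleftrightarrow> sat U (v(n := b)) \<phi>" if "b \<in> S" for b
      using Exists that by (intro Exists.IH) auto
    then show ?case using closed[OF Exists.prems] S_U by auto
  qed simp_all
  moreover have "|S| \<le>o ?u"
    unfolding S_def
    by (rule card_of_UNION_ordLeq_infinite[OF inf countable_le ballI[OF T_card]]) simp
  moreover have "S0 \<subseteq> S" using T_0 by (auto simp: S_def)
  ultimately show thesis using that S_U by blast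
qed

lemma sat_isomorphic_copy:
  assumes "inj_on g S" "range v \<subseteq> g ` S"
  shows "sat (Fo_struct (g ` S) (\<lambda>r xs. I r (map (inv_into S g) xs))) v \<phi> \<longleftrightarrow>
    sat (Fo_struct S I) (inv_into S g \<circ> v) \<phi>"
  using assms(2)
proof (induction \<phi> arbitrary: v)
  case (Eq m n)
  then show ?case using inj_on_inv_into[of "g ` S" g S] by (auto dest!: inj_onD)
next
  case (Exists n \<phi>)
  have "sat (Fo_struct (g ` S) (\<lambda>r xs. I r (map (inv_into S g) xs))) (v(n := g s)) \<phi> \<longleftrightarrow>
      sat (Fo_struct S I) ((inv_into S g \<circ> v)(n := s)) \<phi>" if "s \<in> S" for s
  proof -
    have "inv_into S g \<circ> v(n := g s) = (inv_into S g \<circ> v)(n := s)"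
      using assms(1) that by auto
    moreover have "range (v(n := g s)) \<subseteq> g ` S" using Exists.prems that by auto
    ultimately show ?thesis using Exists.IH by metis
  qed
  then show ?case unfolding sat.simps fo_struct.sel by blast
qed auto

text \<open>This is compactness for the theory of \<open>N\<close> together with the atomic diagram
  of \<open>A\<close>. The image of \<open>A\<close> in the ultrapower is no larger than
  \<open>'u\<close>, so it lies in an elementary substructure that injects into \<open>'u\<close>;
  the model \<open>B\<close> is its copy along such an injection.\<close>

theorem embeds_in_model_if_finite_subsets_embed:
  fixes A :: "('r::{language, countable}, 'u) fo_struct" and N :: "('r, 'a) fo_struct"
  assumes inf: "infinite (UNIV :: 'u set)" and A: "universe A \<noteq> {}"
    and emb: "\<And>X. finite X \<Longrightarrow> X \<subseteq> universe A \<Longrightarrow> \<exists>f. embedding f (Fo_struct X (interp A)) N"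
  shows "\<exists>(B :: ('r, 'u) fo_struct) f. is_model B (complete_theory N) \<and> embedding f A B"
proof -
  obtain a0 where a0: "a0 \<in> universe A" using A by auto
  then obtain f0 where "embedding f0 (Fo_struct {a0} (interp A)) N" using emb[of "{a0}"] by auto
  then have "universe N \<noteq> {}" by (auto simp: embedding_def)
  then obtain F :: "'u set filter" and \<iota> where
    F: "\<And>P. eventually (\<lambda>x. \<not> P x) F \<longleftrightarrow> \<not> eventually P F" and \<iota>: "embedding \<iota> A (ultrapower F N)"
    using embedding_ultrapower[OF _ emb] by metis
  let ?U = "ultrapower F N"
  have "|\<iota> ` universe A| \<le>o |UNIV :: 'u set|"
    by (meson card_of_image card_of_mono1 ordLeq_transitive subset_UNIV)
  moreover have "\<iota> ` universe A \<subseteq> universe ?U" using \<iota> by (simp add: embedding_def)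
  ultimately obtain S where S: "\<iota> ` universe A \<subseteq> S" "S \<subseteq> universe ?U" "|S| \<le>o |UNIV :: 'u set|"
    and el: "\<And>v \<phi>. range v \<subseteq> S \<Longrightarrow> sat (Fo_struct S (interp ?U)) v \<phi> \<longleftrightarrow> sat ?U v \<phi>"
    using downward_Loewenheim_Skolem[OF inf] by metis
  obtain g :: "_ \<Rightarrow> 'u" where g: "inj_on g S" using S(3) card_of_ordLeq[of S "UNIV :: 'u set"] by blast
  define B where "B = Fo_struct (g ` S) (\<lambda>r xs. interp ?U r (map (inv_into S g) xs))"
  have "B \<Turnstile> \<phi>" if "\<phi> \<in> complete_theory N" for \<phi>
    unfolding holds_def
  proof (intro allI impI)
    fix v :: "nat \<Rightarrow> _" assume "range v \<subseteq> universe B"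
    then have v: "range v \<subseteq> g ` S" by (simp add: B_def)
    have r: "range (inv_into S g \<circ> v) \<subseteq> S" using v by (auto intro!: inv_into_into)
    have "?U \<Turnstile> \<phi>" using that by (intro ultrapower_sentence F) (simp add: complete_theory_def)
    then have "sat ?U (inv_into S g \<circ> v) \<phi>" using r S(2) unfolding holds_def by blast
    then show "sat B v \<phi>" unfolding B_def sat_isomorphic_copy[OF g v] el[OF r] .
  qed
  moreover have "universe B \<noteq> {}" using S(1) A by (auto simp: B_def)
  moreover have "embedding (g \<circ> \<iota>) A B"
    unfolding embedding_def
  proof (intro conjI allI impI)
    show "(g \<circ> \<iota>) ` universe A \<subseteq> universe B" using S(1) by (auto simp: B_def)
    show "inj_on (g \<circ> \<iota>) (universe A)"
      using \<iota> g S(1) by (auto simp: embedding_def intro: comp_inj_on inj_on_subset)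
    fix r :: 'r and xs assume xs: "length xs = arity r \<and> set xs \<subseteq> universe A"
    then have "map (inv_into S g) (map (g \<circ> \<iota>) xs) = map \<iota> xs"
      using S(1) g by (auto intro!: inv_into_f_f)
    then show "interp A r xs = interp B r (map (g \<circ> \<iota>) xs)"
      using \<iota> xs by (simp add: embedding_def B_def del: map_map)
  qed
  ultimately show ?thesis unfolding is_model_def by blast
qed

section \<open>Labeled switchboards\<close>

lemma embedding_comp:
  fixes A :: "('r::language, 'a) fo_struct"
  assumes f: "embedding f A B" and g: "embedding g B C"
  shows "embedding (g \<circ> f) A C"
  unfolding embedding_def
proof (intro conjI allI impI)
  show "(g \<circ> f) ` universe A \<subseteq> universe C"
    using f g unfolding embedding_def by fastforce
  show "inj_on (g \<circ> f) (universe A)"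
    using f g unfolding embedding_def by (blast intro: comp_inj_on inj_on_subset)
  fix r :: 'r and xs assume xs: "length xs = arity r \<and> set xs \<subseteq> universe A"
  then have "interp A r xs = interp B r (map f xs)"
    using f unfolding embedding_def by blast
  also have "\<dots> = interp C r (map g (map f xs))"
  proof -
    have "length (map f xs) = arity r \<and> set (map f xs) \<subseteq> universe B"
      using f xs unfolding embedding_def by auto
    then show ?thesis using g unfolding embedding_def by blast
  qed
  finally show "interp A r xs = interp C r (map (g \<circ> f) xs)" by simp
qed

lemma embedding_substructure:
  "X \<subseteq> universe A \<Longrightarrow> embedding (\<lambda>x. x) (Fo_struct X (interp A)) A"
  by (simp add: embedding_def)

text \<open>\<open>age\<close> and \<open>finite_labeled_switchboards\<close> consist of structures
  on natural numbers; such copies make them applicable to finite structures over any type.\<close>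

lemma finite_struct_nat_copy:
  fixes A :: "('r::language, 'a) fo_struct"
  assumes "finite (universe A)"
  obtains B :: "('r, nat) fo_struct" and f g
  where "finite (universe B)" "embedding f A B" "embedding g B A"
proof -
  obtain f :: "'a \<Rightarrow> nat" where f: "inj_on f (universe A)"
    using finite_imp_inj_to_nat_seg[OF assms] by blast
  let ?g = "inv_into (universe A) f"
  let ?B = "Fo_struct (f ` universe A) (\<lambda>r xs. interp A r (map ?g xs))"
  have "map ?g (map f xs) = xs" if "set xs \<subseteq> universe A" for xs
    using that f by (auto simp: subset_iff intro!: map_idI)
  then have "embedding f A ?B" using f by (simp add: embedding_def del: map_map)
  moreover have "embedding ?g ?B A"
    using f by (auto simp: embedding_def inj_on_inv_into inv_into_into)
  ultimately show thesis using that[of ?B] assms by simp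
qed

lemma image_in_nsets:
  assumes "inj_on f A" "f ` A \<subseteq> B" "p \<in> [A]\<^bsup>k\<^esup>"
  shows "f ` p \<in> [B]\<^bsup>k\<^esup>"
  using assms by (auto simp: nsets_def card_image inj_on_subset)

text \<open>The last clause merges irreflexivity (\<open>y = z\<close>) with the incomparability of
  pairs sharing a point (\<open>y \<noteq> z\<close>).\<close>

lemma switchboardD:
  assumes "switchboard U lt"
  shows "irreflp_on ([U]\<^bsup>2\<^esup>) lt" "transp_on ([U]\<^bsup>2\<^esup>) lt"
    and "\<lbrakk>x \<in> U; y \<in> U; z \<in> U; x \<noteq> y; x \<noteq> z\<rbrakk> \<Longrightarrow> \<not> lt {x, y} {x, z}"
proof -
  note * = assms[unfolded switchboard_def]
  show ir: "irreflp_on ([U]\<^bsup>2\<^esup>) lt" and "transp_on ([U]\<^bsup>2\<^esup>) lt" using * by simp_all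
  assume U: "x \<in> U" "y \<in> U" "z \<in> U" and ne: "x \<noteq> y" "x \<noteq> z"
  show "\<not> lt {x, y} {x, z}"
  proof (cases "y = z")
    case True
    then show ?thesis using irreflp_onD[OF ir, of "{x, y}"] U ne by simp
  next
    case False
    then show ?thesis
      using *[THEN conjunct2, THEN conjunct2, rule_format, OF U] ne by simp
  qed
qed

text \<open>Trichotomy is recast so that \<open>up\<close> is the case left over by membership and
  \<open>down\<close>; the labelings constructed below specify only \<open>down\<close>.\<close>

lemma labeled_switchboardD:
  assumes "labeled_switchboard U lt up down"
  shows "switchboard U lt"
    and "\<lbrakk>a \<in> U; p \<in> [U]\<^bsup>2\<^esup>\<rbrakk> \<Longrightarrow> up a p \<longleftrightarrow> a \<notin> p \<and> \<not> down a p"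
    and "\<lbrakk>a \<in> U; p \<in> [U]\<^bsup>2\<^esup>; a \<in> p\<rbrakk> \<Longrightarrow> \<not> down a p"
    and "\<lbrakk>a \<in> U; p \<in> [U]\<^bsup>2\<^esup>; q \<in> [U]\<^bsup>2\<^esup>; up a p; lt p q\<rbrakk> \<Longrightarrow> up a q"
    and "\<lbrakk>a \<in> U; p \<in> [U]\<^bsup>2\<^esup>; q \<in> [U]\<^bsup>2\<^esup>; down a p; lt q p\<rbrakk> \<Longrightarrow> down a q"
proof -
  note * = assms[unfolded labeled_switchboard_def]
  show "switchboard U lt" using * by blast
  show "\<lbrakk>a \<in> U; p \<in> [U]\<^bsup>2\<^esup>\<rbrakk> \<Longrightarrow> up a p \<longleftrightarrow> a \<notin> p \<and> \<not> down a p"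
    and "\<lbrakk>a \<in> U; p \<in> [U]\<^bsup>2\<^esup>; a \<in> p\<rbrakk> \<Longrightarrow> \<not> down a p"
    using *[THEN conjunct2, THEN conjunct1, rule_format, of a p] by blast+
  show "\<lbrakk>a \<in> U; p \<in> [U]\<^bsup>2\<^esup>; q \<in> [U]\<^bsup>2\<^esup>; up a p; lt p q\<rbrakk> \<Longrightarrow> up a q"
    using *[THEN conjunct2, THEN conjunct2, THEN conjunct1, rule_format, of a p q] by blast
  show "\<lbrakk>a \<in> U; p \<in> [U]\<^bsup>2\<^esup>; q \<in> [U]\<^bsup>2\<^esup>; down a p; lt q p\<rbrakk> \<Longrightarrow> down a q"
    using *[THEN conjunct2, THEN conjunct2, THEN conjunct2, rule_format, of a p q] by blast
qed

lemma labeled_switchboardI: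
  assumes "irreflp_on ([U]\<^bsup>2\<^esup>) lt" "transp_on ([U]\<^bsup>2\<^esup>) lt"
    and "\<And>x y z. \<lbrakk>x \<in> U; y \<in> U; z \<in> U; x \<noteq> y; x \<noteq> z; y \<noteq> z\<rbrakk> \<Longrightarrow> \<not> lt {x, y} {x, z}"
    and "\<And>a p. \<lbrakk>a \<in> U; p \<in> [U]\<^bsup>2\<^esup>\<rbrakk> \<Longrightarrow> up a p \<longleftrightarrow> a \<notin> p \<and> \<not> down a p"
    and "\<And>a p. \<lbrakk>a \<in> U; p \<in> [U]\<^bsup>2\<^esup>; a \<in> p\<rbrakk> \<Longrightarrow> \<not> down a p"
    and "\<And>a p q. \<lbrakk>a \<in> U; p \<in> [U]\<^bsup>2\<^esup>; q \<in> [U]\<^bsup>2\<^esup>; up a p; lt p q\<rbrakk> \<Longrightarrow> up a q"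
    and "\<And>a p q. \<lbrakk>a \<in> U; p \<in> [U]\<^bsup>2\<^esup>; q \<in> [U]\<^bsup>2\<^esup>; down a p; lt q p\<rbrakk> \<Longrightarrow> down a q"
  shows "labeled_switchboard U lt up down"
  unfolding labeled_switchboard_def switchboard_def
proof (intro conjI ballI impI)
  fix a p assume "a \<in> U" "p \<in> [U]\<^bsup>2\<^esup>"
  then show "up a p \<and> a \<notin> p \<and> \<not> down a p \<or> \<not> up a p \<and> a \<in> p \<and> \<not> down a p \<or>
      \<not> up a p \<and> a \<notin> p \<and> down a p"
    using assms(4)[of a p] assms(5)[of a p] by blast
next
  fix x y z assume "x \<in> U" "y \<in> U" "z \<in> U" "x \<noteq> y \<and> x \<noteq> z \<and> y \<noteq> z"
  then show "\<not> lt {x, y} {x, z}" "\<not> lt {x, z} {x, y}"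
    using assms(3)[of x y z] assms(3)[of x z y] by blast+
next
  fix a p q assume "a \<in> U" "p \<in> [U]\<^bsup>2\<^esup>" "q \<in> [U]\<^bsup>2\<^esup>"
  then show "up a p \<and> lt p q \<Longrightarrow> up a q" "down a p \<and> lt q p \<Longrightarrow> down a q"
    using assms(6)[of a p q] assms(7)[of a p q] by blast+
qed (rule assms)+

lemma labeled_switchboard_vimage:
  assumes B: "labeled_switchboard B lt up down" and f: "inj_on f A" "f ` A \<subseteq> B"
  shows "labeled_switchboard A (\<lambda>p q. lt (f ` p) (f ` q))
    (\<lambda>a p. up (f a) (f ` p)) (\<lambda>a p. down (f a) (f ` p))"
proof -
  note im = image_in_nsets[OF f]
  have fB: "f a \<in> B" if "a \<in> A" for a using f that by auto
  note BD = labeled_switchboardD[OF B]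
  note sb = switchboardD[OF BD(1)]
  have mem: "f a \<in> f ` p \<longleftrightarrow> a \<in> p" if "a \<in> A" "p \<in> [A]\<^bsup>2\<^esup>" for a p
    using f that by (auto simp: nsets_def inj_on_image_mem_iff)
  show ?thesis
  proof (rule labeled_switchboardI)
    show "irreflp_on ([A]\<^bsup>2\<^esup>) (\<lambda>p q. lt (f ` p) (f ` q))"
      using irreflp_onD[OF sb(1) im] by (rule irreflp_onI)
    show "transp_on ([A]\<^bsup>2\<^esup>) (\<lambda>p q. lt (f ` p) (f ` q))"
      by (rule transp_onI) (rule transp_onD[OF sb(2) im im im])
  next
    fix x y z assume "x \<in> A" "y \<in> A" "z \<in> A" "x \<noteq> y" "x \<noteq> z"
    then show "\<not> lt (f ` {x, y}) (f ` {x, z})"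
      using sb(3)[of "f x" "f y" "f z"] fB f(1) by (simp add: inj_on_eq_iff)
  next
    fix a p assume "a \<in> A" "p \<in> [A]\<^bsup>2\<^esup>"
    then show "up (f a) (f ` p) \<longleftrightarrow> a \<notin> p \<and> \<not> down (f a) (f ` p)"
      "a \<in> p \<Longrightarrow> \<not> down (f a) (f ` p)"
      using BD(2,3)[OF fB im] mem by simp_all
  qed (use BD(4,5)[OF fB im im] in blast)+
qed

text \<open>All axioms are universal, so the relations of \<open>B\<close> pulled back along
  \<open>f\<close> satisfy them again.\<close>

lemma labeled_switchboard_struct_embedding:
  assumes f: "embedding f A B" and "labeled_switchboard_struct B"
  shows "labeled_switchboard_struct A"
proof -
  let ?U = "universe A" and ?V = "universe B"
  obtain lt up down where B: "labeled_switchboard ?V lt up down"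
    and less: "\<forall>x\<in>?V. \<forall>y\<in>?V. \<forall>z\<in>?V. \<forall>w\<in>?V.
      interp B (Base Less) [x, y, z, w] \<longleftrightarrow> x \<noteq> y \<and> z \<noteq> w \<and> lt {x, y} {z, w}"
    and ud: "\<forall>a\<in>?V. \<forall>b\<in>?V. \<forall>c\<in>?V.
      (interp B Up [a, b, c] \<longleftrightarrow> b \<noteq> c \<and> up a {b, c}) \<and>
      (interp B Down [a, b, c] \<longleftrightarrow> b \<noteq> c \<and> down a {b, c})"
    using assms(2) unfolding labeled_switchboard_struct_def by (elim exE conjE)
  have inj: "inj_on f ?U" and sub: "f ` ?U \<subseteq> ?V" using f by (simp_all add: embedding_def)
  have fV: "f a \<in> ?V" if "a \<in> ?U" for a using sub that by auto
  have f_eq: "f x = f y \<longleftrightarrow> x = y" if "x \<in> ?U" "y \<in> ?U" for x y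
    using inj that by (simp add: inj_on_eq_iff)
  have int: "interp A r xs \<longleftrightarrow> interp B r (map f xs)"
    if "length xs = arity r" "set xs \<subseteq> ?U" for r xs
    using f that unfolding embedding_def by blast
  show ?thesis
    unfolding labeled_switchboard_struct_def
  proof (intro exI conjI ballI)
    show "labeled_switchboard ?U (\<lambda>p q. lt (f ` p) (f ` q))
        (\<lambda>a p. up (f a) (f ` p)) (\<lambda>a p. down (f a) (f ` p))"
      using labeled_switchboard_vimage[OF B inj sub] .
  next
    fix x y z w assume "x \<in> ?U" "y \<in> ?U" "z \<in> ?U" "w \<in> ?U"
    then show "interp A (Base Less) [x, y, z, w] \<longleftrightarrow>
        x \<noteq> y \<and> z \<noteq> w \<and> lt (f ` {x, y}) (f ` {z, w})"
      using int[of "[x, y, z, w]" "Base Less"] less[rule_format, of "f x" "f y" "f z" "f w"]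
      by (simp add: fV f_eq)
  next
    fix a b c assume "a \<in> ?U" "b \<in> ?U" "c \<in> ?U"
    then show "interp A Up [a, b, c] \<longleftrightarrow> b \<noteq> c \<and> up (f a) (f ` {b, c})"
      "interp A Down [a, b, c] \<longleftrightarrow> b \<noteq> c \<and> down (f a) (f ` {b, c})"
      using int[of "[a, b, c]" Up] int[of "[a, b, c]" Down] ud[rule_format, of "f a" "f b" "f c"]
      by (simp_all add: fV f_eq)
  qed
qed

definition labeled_struct ::
    "'a set \<Rightarrow> ('a set \<Rightarrow> 'a set \<Rightarrow> bool) \<Rightarrow> ('a \<Rightarrow> 'a set \<Rightarrow> bool) \<Rightarrow> ('a \<Rightarrow> 'a set \<Rightarrow> bool) \<Rightarrow>
      (L_plus, 'a) fo_struct" where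
  "labeled_struct U lt up down = Fo_struct U (\<lambda>r xs. case r of
      Base _ \<Rightarrow> xs ! 0 \<noteq> xs ! 1 \<and> xs ! 2 \<noteq> xs ! 3 \<and> lt {xs ! 0, xs ! 1} {xs ! 2, xs ! 3}
    | Up \<Rightarrow> xs ! 1 \<noteq> xs ! 2 \<and> up (xs ! 0) {xs ! 1, xs ! 2}
    | Down \<Rightarrow> xs ! 1 \<noteq> xs ! 2 \<and> down (xs ! 0) {xs ! 1, xs ! 2})"

lemma labeled_struct_simps [simp]:
  "universe (labeled_struct U lt up down) = U"
  "interp (labeled_struct U lt up down) (Base r) [x, y, z, w] \<longleftrightarrow>
     x \<noteq> y \<and> z \<noteq> w \<and> lt {x, y} {z, w}"
  "interp (labeled_struct U lt up down) Up [x, y, z] \<longleftrightarrow> y \<noteq> z \<and> up x {y, z}"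
  "interp (labeled_struct U lt up down) Down [x, y, z] \<longleftrightarrow> y \<noteq> z \<and> down x {y, z}"
  by (simp_all add: labeled_struct_def numeral_2_eq_2 numeral_3_eq_3)

lemma labeled_switchboard_struct_labeled_struct:
  "labeled_switchboard U lt up down \<Longrightarrow> labeled_switchboard_struct (labeled_struct U lt up down)"
  unfolding labeled_switchboard_struct_def by (intro exI[of _ lt] exI[of _ up] exI[of _ down]) simp

lemma nsets_2_memE:
  assumes "x \<in> p" "p \<in> [U]\<^bsup>2\<^esup>"
  obtains y where "p = {x, y}" "x \<noteq> y" "x \<in> U" "y \<in> U"
proof -
  obtain u v where "p = {u, v}" "u \<noteq> v" "u \<in> U" "v \<in> U" using assms(2) by (rule nsets2_E)
  then show thesis using that[of u] that[of v] assms(1) by (auto simp: insert_commute)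
qed

text \<open>A pair \<open>{a, d}\<close> above \<open>p\<close> forces \<open>down a p\<close> in
  any labeling; here exactly the forced cases are labeled \<open>down\<close> and the rest
  \<open>up\<close>. Upward and Downward then both come from transitivity and the incomparability of
  pairs sharing a point.\<close>

lemma switchboard_labeling:
  assumes sb: "switchboard U lt"
  obtains up down where "labeled_switchboard U lt up down"
proof -
  define down where "down a p \<longleftrightarrow> a \<notin> p \<and> (\<exists>d\<in>U. d \<noteq> a \<and> lt p {a, d})" for a p
  define up where "up a p \<longleftrightarrow> a \<notin> p \<and> \<not> down a p" for a p
  note tr = switchboardD(2)[OF sb] and share = switchboardD(3)[OF sb]
  have share': "\<not> lt p q" if x: "x \<in> p" "x \<in> q" and pq: "p \<in> [U]\<^bsup>2\<^esup>" "q \<in> [U]\<^bsup>2\<^esup>" for x p q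
  proof -
    obtain y where "p = {x, y}" "x \<noteq> y" "x \<in> U" "y \<in> U" using x(1) pq(1) by (rule nsets_2_memE)
    moreover obtain z where "q = {x, z}" "x \<noteq> z" "z \<in> U" using x(2) pq(2) by (rule nsets_2_memE)
    ultimately show ?thesis using share by simp
  qed
  have "labeled_switchboard U lt up down"
  proof (rule labeled_switchboardI)
    fix a p assume "a \<in> U" "p \<in> [U]\<^bsup>2\<^esup>"
    show "up a p \<longleftrightarrow> a \<notin> p \<and> \<not> down a p" by (simp add: up_def)
    show "a \<in> p \<Longrightarrow> \<not> down a p" by (simp add: down_def)
  next
    fix a p q assume a: "a \<in> U" and p: "p \<in> [U]\<^bsup>2\<^esup>" and q: "q \<in> [U]\<^bsup>2\<^esup>" and "up a p" and lt: "lt p q"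
    then have up: "a \<notin> p" "\<not> (\<exists>d\<in>U. d \<noteq> a \<and> lt p {a, d})"
      by (auto simp: up_def down_def)
    have "a \<notin> q"
    proof
      assume "a \<in> q"
      then obtain d where "q = {a, d}" "a \<noteq> d" "d \<in> U" using q by (rule nsets_2_memE)
      then show False using up lt by auto
    qed
    moreover have "\<not> lt q {a, d}" if "d \<in> U" "d \<noteq> a" for d
    proof
      assume "lt q {a, d}"
      then have "lt p {a, d}" using transp_onD[OF tr p q _ lt, of "{a, d}"] a that by simp
      then show False using up that by blast
    qed
    ultimately show "up a q" by (auto simp: up_def down_def)
  next
    fix a p q assume a: "a \<in> U" and p: "p \<in> [U]\<^bsup>2\<^esup>" and q: "q \<in> [U]\<^bsup>2\<^esup>" and "down a p" and lt: "lt q p"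
    then obtain d where d: "d \<in> U" "d \<noteq> a" "lt p {a, d}"
      by (auto simp: down_def)
    have ad: "{a, d} \<in> [U]\<^bsup>2\<^esup>" using a d by simp
    have "lt q {a, d}" by (rule transp_onD[OF tr q p ad lt d(3)])
    moreover have "a \<notin> q" using share'[of a q "{a, d}"] q ad \<open>lt q {a, d}\<close> by blast
    ultimately show "down a q" using d by (auto simp: down_def)
  qed (use switchboardD[OF sb] in blast)+
  then show thesis by (rule that)
qed

section \<open>The Fraisse limit of the finite labeled switchboards\<close>

lemma fraisse_limit_finite_substructure:
  assumes M: "fraisse_limit finite_labeled_switchboards M" and X: "finite X" "X \<subseteq> universe M"
  shows "labeled_switchboard_struct (Fo_struct X (interp M))"
proof -
  let ?X = "Fo_struct X (interp M)"
  have "finite (universe ?X)" using X by simp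
  then obtain B :: "(L_plus, nat) fo_struct" and f g
    where B: "finite (universe B)" "embedding f ?X B" "embedding g B ?X"
    by (rule finite_struct_nat_copy)
  have "B \<in> age M"
    using B embedding_comp[OF B(3) embedding_substructure[OF X(2)]] by (auto simp: age_def)
  then have "labeled_switchboard_struct B"
    using M by (simp add: fraisse_limit_def finite_labeled_switchboards_def)
  then show ?thesis using labeled_switchboard_struct_embedding B(2) by blast
qed

lemma fraisse_limit_embeds:
  assumes M: "fraisse_limit finite_labeled_switchboards M"
    and A: "finite (universe A)" "labeled_switchboard_struct A"
  obtains f where "embedding f A M"
proof -
  obtain B :: "(L_plus, nat) fo_struct" and f g
    where B: "finite (universe B)" "embedding f A B" "embedding g B A"
    using A(1) by (rule finite_struct_nat_copy)
  then have "B \<in> finite_labeled_switchboards"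
    using A(2) labeled_switchboard_struct_embedding by (auto simp: finite_labeled_switchboards_def)
  then obtain h where "embedding h B M"
    using M by (auto simp: fraisse_limit_def age_def)
  then show thesis using that embedding_comp[OF B(2)] by blast
qed

text \<open>The relations obtained depend on \<open>X\<close>, so an argument about several points
  puts all of them into one \<open>X\<close>.\<close>

lemma fraisse_limit_labels:
  assumes M: "fraisse_limit finite_labeled_switchboards M" and X: "finite X" "X \<subseteq> universe M"
  obtains lt up down where "labeled_switchboard X lt up down"
    "\<And>x y z w. \<lbrakk>x \<in> X; y \<in> X; z \<in> X; w \<in> X\<rbrakk> \<Longrightarrow>
      interp M (Base Less) [x, y, z, w] \<longleftrightarrow> x \<noteq> y \<and> z \<noteq> w \<and> lt {x, y} {z, w}"
    "\<And>a b c. \<lbrakk>a \<in> X; b \<in> X; c \<in> X\<rbrakk> \<Longrightarrow> interp M Up [a, b, c] \<longleftrightarrow> b \<noteq> c \<and> up a {b, c}"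
    "\<And>a b c. \<lbrakk>a \<in> X; b \<in> X; c \<in> X\<rbrakk> \<Longrightarrow> interp M Down [a, b, c] \<longleftrightarrow> b \<noteq> c \<and> down a {b, c}"
proof -
  obtain lt up down where *: "labeled_switchboard X lt up down"
    "\<forall>x\<in>X. \<forall>y\<in>X. \<forall>z\<in>X. \<forall>w\<in>X.
      interp M (Base Less) [x, y, z, w] \<longleftrightarrow> x \<noteq> y \<and> z \<noteq> w \<and> lt {x, y} {z, w}"
    "\<forall>a\<in>X. \<forall>b\<in>X. \<forall>c\<in>X. (interp M Up [a, b, c] \<longleftrightarrow> b \<noteq> c \<and> up a {b, c}) \<and>
      (interp M Down [a, b, c] \<longleftrightarrow> b \<noteq> c \<and> down a {b, c})"
    using fraisse_limit_finite_substructure[OF M X]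
    unfolding labeled_switchboard_struct_def fo_struct.sel by (elim exE conjE)
  show thesis
    by (rule that[OF *(1)]) (simp_all only: *(2,3)[rule_format])
qed

section \<open>Labels forced and realised by comparisons\<close>

text \<open>By Upward, \<open>up a {b, c}\<close> would give \<open>up a {a, d}\<close>, although
  \<open>a\<close> lies in \<open>{a, d}\<close>. The next lemma is the dual, by Downward.\<close>

lemma labeled_switchboard_down:
  assumes L: "labeled_switchboard U lt up down" and U: "a \<in> U" "b \<in> U" "c \<in> U" "d \<in> U"
    and ne: "a \<noteq> d" "b \<noteq> c" and lt: "lt {b, c} {a, d}"
  shows "a \<notin> {b, c}" "down a {b, c}"
proof -
  note share = switchboardD(3)[OF labeled_switchboardD(1)[OF L]]
  have bc: "{b, c} \<in> [U]\<^bsup>2\<^esup>" and ad: "{a, d} \<in> [U]\<^bsup>2\<^esup>" using U ne by simp_all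
  show a: "a \<notin> {b, c}"
    using share[of a b d] share[of a c d] lt U ne by (auto simp: insert_commute)
  have "\<not> up a {a, d}" using labeled_switchboardD(2)[OF L U(1) ad] by simp
  then have "\<not> up a {b, c}" using labeled_switchboardD(4)[OF L U(1) bc ad _ lt] by blast
  then show "down a {b, c}" using labeled_switchboardD(2)[OF L U(1) bc] a by blast
qed

lemma labeled_switchboard_up:
  assumes L: "labeled_switchboard U lt up down" and U: "a \<in> U" "b \<in> U" "c \<in> U" "d \<in> U"
    and ne: "a \<noteq> d" "b \<noteq> c" and lt: "lt {a, d} {b, c}"
  shows "up a {b, c}"
proof -
  have bc: "{b, c} \<in> [U]\<^bsup>2\<^esup>" and ad: "{a, d} \<in> [U]\<^bsup>2\<^esup>" using U ne by simp_all
  note share = switchboardD(3)[OF labeled_switchboardD(1)[OF L]]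
  have "a \<notin> {b, c}"
    using share[of a d b] share[of a d c] lt U ne by (auto simp: insert_commute)
  moreover have "\<not> down a {b, c}"
    using labeled_switchboardD(5)[OF L U(1) bc ad _ lt] labeled_switchboardD(3)[OF L U(1) ad] by blast
  ultimately show ?thesis using labeled_switchboardD(2)[OF L U(1) bc] by blast
qed

text \<open>\<open>None\<close> is the new point \<open>d\<close>, and \<open>{a, d}\<close> is put
  above or below \<open>{b, c}\<close> as the label of \<open>a\<close> demands. Old labels are
  kept. The comparison dictates how \<open>d\<close> is labeled at \<open>{b, c}\<close> and how
  \<open>b\<close> and \<open>c\<close> are labeled at \<open>{a, d}\<close>; every other new label
  is \<open>up\<close> by default.\<close>

lemma labeled_switchboard_one_point_extension:
  assumes L: "labeled_switchboard {a, b, c} lt up down" and ne: "a \<noteq> b" "a \<noteq> c" "b \<noteq> c"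
  defines "lt' \<equiv> \<lambda>p q. if down a {b, c} then p = {Some b, Some c} \<and> q = {Some a, None}
      else p = {Some a, None} \<and> q = {Some b, Some c}"
    and "down' \<equiv> \<lambda>x p. (x \<noteq> None \<and> None \<notin> p \<and> down (the x) (the ` p)) \<or>
      (down a {b, c} \<and> x = None \<and> p = {Some b, Some c}) \<or>
      (\<not> down a {b, c} \<and> x \<in> {Some b, Some c} \<and> p = {Some a, None})"
  shows "labeled_switchboard {Some a, Some b, Some c, None} lt' (\<lambda>x p. x \<notin> p \<and> \<not> down' x p) down'"
proof -
  let ?U = "{Some a, Some b, Some c, None}"
  have down_not_mem: "\<not> down x p" if "x \<in> p" "x \<in> {a, b, c}" "p \<in> [{a, b, c}]\<^bsup>2\<^esup>" for x p
    using labeled_switchboardD(3)[OF L that(2,3,1)] .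
  have disj: "x \<notin> p" if "x \<in> ?U" "p \<in> [?U]\<^bsup>2\<^esup>" "down' x p" for x p
  proof
    assume x: "x \<in> p"
    have "\<not> (x \<noteq> None \<and> None \<notin> p \<and> down (the x) (the ` p))"
    proof (intro notI, elim conjE)
      assume *: "x \<noteq> None" "None \<notin> p" "down (the x) (the ` p)"
      have p: "p \<in> [?U - {None}]\<^bsup>2\<^esup>" using that(2) *(2) by (auto simp: nsets_def)
      have "inj_on the (?U - {None})" "the ` (?U - {None}) \<subseteq> {a, b, c}" by (auto simp: inj_on_def)
      from image_in_nsets[OF this p] have "the ` p \<in> [{a, b, c}]\<^bsup>2\<^esup>" .
      then show False using down_not_mem[of "the x" "the ` p"] *(1,3) x that(1) by auto
    qed
    then show False using that(3) x ne by (auto simp: down'_def)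
  qed
  \<comment> \<open>The lower and upper pair of the only comparison. Together they contain every
    point, so no point is \<open>up\<close> at \<open>lo\<close> and none is \<open>down\<close> at
    \<open>hi\<close>: Upward and Downward hold vacuously.\<close>
  define lo where "lo = (if down a {b, c} then {Some b, Some c} else {Some a, None})"
  define hi where "hi = (if down a {b, c} then {Some a, None} else {Some b, Some c})"
  have lt': "lt' p q \<longleftrightarrow> p = lo \<and> q = hi" for p q
    by (simp add: lt'_def lo_def hi_def)
  have lo_hi: "lo \<inter> hi = {}" "lo \<noteq> hi" and cover: "?U \<subseteq> lo \<union> hi"
    using ne by (auto simp: lo_def hi_def doubleton_eq_iff)
  have down_lo: "down' x lo" if "x \<in> hi" for x
    using that by (auto simp: down'_def lo_def hi_def split: if_splits)
  have not_down_hi: "\<not> down' x hi" if "x \<in> lo" for x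
    using that by (auto simp: down'_def lo_def hi_def doubleton_eq_iff split: if_splits)
  show ?thesis
  proof (rule labeled_switchboardI)
    show "irreflp_on ([?U]\<^bsup>2\<^esup>) lt'" "transp_on ([?U]\<^bsup>2\<^esup>) lt'"
      using lo_hi(2) by (auto simp: irreflp_on_def transp_on_def lt')
    show "\<not> lt' {x, y} {x, z}" for x y z
      unfolding lt' using lo_hi(1) by blast
    show "(x \<notin> p \<and> \<not> down' x p) \<longleftrightarrow> x \<notin> p \<and> \<not> down' x p" for x p
      by (rule refl)
    show "\<not> down' x p" if "x \<in> ?U" "p \<in> [?U]\<^bsup>2\<^esup>" "x \<in> p" for x p
      using disj[of x p] that by blast
  next
    fix x p q assume "x \<in> ?U" "x \<notin> p \<and> \<not> down' x p" "lt' p q"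
    then show "x \<notin> q \<and> \<not> down' x q"
      using cover down_lo unfolding lt' by blast
  next
    fix x p q assume "x \<in> ?U" "p \<in> [?U]\<^bsup>2\<^esup>" "down' x p" "lt' q p"
    then show "down' x q"
      using cover disj[of x p] not_down_hi unfolding lt' by blast
  qed
qed

lemma fraisse_limit_witness:
  assumes M: "fraisse_limit finite_labeled_switchboards M"
    and U: "a \<in> universe M" "b \<in> universe M" "c \<in> universe M"
    and ne: "a \<noteq> b" "a \<noteq> c" "b \<noteq> c"
  obtains d where "d \<in> universe M"
    "if interp M Down [a, b, c] then interp M (Base Less) [b, c, a, d]
     else interp M (Base Less) [a, d, b, c]"
proof -
  let ?X = "{a, b, c}"
  have X: "finite ?X" "?X \<subseteq> universe M" using U by simp_all
  obtain lt up down where L: "labeled_switchboard ?X lt up down"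
    and less: "\<And>x y z w. \<lbrakk>x \<in> ?X; y \<in> ?X; z \<in> ?X; w \<in> ?X\<rbrakk> \<Longrightarrow>
      interp M (Base Less) [x, y, z, w] \<longleftrightarrow> x \<noteq> y \<and> z \<noteq> w \<and> lt {x, y} {z, w}"
    and up_iff: "\<And>a b c. \<lbrakk>a \<in> ?X; b \<in> ?X; c \<in> ?X\<rbrakk> \<Longrightarrow> interp M Up [a, b, c] \<longleftrightarrow> b \<noteq> c \<and> up a {b, c}"
    and down_iff: "\<And>a b c. \<lbrakk>a \<in> ?X; b \<in> ?X; c \<in> ?X\<rbrakk> \<Longrightarrow>
      interp M Down [a, b, c] \<longleftrightarrow> b \<noteq> c \<and> down a {b, c}"
    using fraisse_limit_labels[OF M X] by blast
  define lt' where "lt' \<equiv> \<lambda>p q. if down a {b, c} then p = {Some b, Some c} \<and> q = {Some a, None}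
      else p = {Some a, None} \<and> q = {Some b, Some c}"
  define down' where "down' \<equiv> \<lambda>x p. (x \<noteq> None \<and> None \<notin> p \<and> down (the x) (the ` p)) \<or>
      (down a {b, c} \<and> x = None \<and> p = {Some b, Some c}) \<or>
      (\<not> down a {b, c} \<and> x \<in> {Some b, Some c} \<and> p = {Some a, None})"
  define D where "D = labeled_struct {Some a, Some b, Some c, None} lt'
      (\<lambda>x p. x \<notin> p \<and> \<not> down' x p) down'"
  have "labeled_switchboard_struct D"
    unfolding D_def lt'_def down'_def
    by (intro labeled_switchboard_struct_labeled_struct labeled_switchboard_one_point_extension[OF L ne])
  then obtain h where h: "embedding h D M"
    using fraisse_limit_embeds[OF M, of D] by (auto simp: D_def)
  have h_int: "interp D r xs \<longleftrightarrow> interp M r (map h xs)"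
    if "length xs = arity r" "set xs \<subseteq> {Some a, Some b, Some c, None}" for r xs
    using h that by (simp add: embedding_def D_def)
  have h_inj: "inj_on h {Some a, Some b, Some c, None}"
    and h_im: "h ` {Some a, Some b, Some c, None} \<subseteq> universe M"
    using h by (simp_all add: embedding_def D_def)
  define e where "e = (\<lambda>x. h (Some x))"
  have e_inj: "inj_on e ?X" using h_inj by (auto simp: inj_on_def e_def)
  have e_im: "e ` ?X \<subseteq> universe M" using h_im by (auto simp: e_def)
  \<comment> \<open>On the old points \<open>D\<close> agrees with \<open>M\<close>: pairs inside
    three points share a point, so neither side has a comparison, and the labels were
    copied.\<close>
  have D_int: "interp D r (map Some xs) \<longleftrightarrow> interp M r xs"
    if len: "length xs = arity r" and xs: "set xs \<subseteq> ?X" for r xs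
  proof (cases r)
    case (Base s)
    then have "length xs = 4" using len by (cases s) simp
    then obtain x y z w where xs_eq: "xs = [x, y, z, w]"
      by (auto simp: numeral_eq_Suc length_Suc_conv)
    have "\<not> lt {x, y} {z, w}" if "x \<noteq> y" "z \<noteq> w"
    proof -
      note share = switchboardD(3)[OF labeled_switchboardD(1)[OF L]]
      have "x = z \<or> x = w \<or> y = z \<or> y = w" using xs xs_eq that by auto
      moreover have "x \<in> ?X" "y \<in> ?X" "z \<in> ?X" "w \<in> ?X" using xs xs_eq by simp_all
      ultimately show ?thesis
        using share[of x y w] share[of x y z] share[of y x w] share[of y x z] that
        by (metis insert_commute)
    qed
    then have "\<not> interp M r xs" using less[of x y z w] xs xs_eq Base by (cases s) auto
    moreover have "\<not> interp D r (map Some xs)"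
      using Base by (auto simp: D_def xs_eq lt'_def doubleton_eq_iff split: if_splits)
    ultimately show ?thesis by blast
  next
    case Up
    then obtain x y z where xs_eq: "xs = [x, y, z]"
      using len by (auto simp: numeral_eq_Suc length_Suc_conv)
    have "down' (Some x) {Some y, Some z} \<longleftrightarrow> down x {y, z}"
      by (auto simp: down'_def doubleton_eq_iff)
    moreover have "y \<noteq> z \<Longrightarrow> up x {y, z} \<longleftrightarrow> x \<notin> {y, z} \<and> \<not> down x {y, z}"
      using xs xs_eq by (intro labeled_switchboardD(2)[OF L]) simp_all
    ultimately show ?thesis
      using Up xs xs_eq up_iff[of x y z]
      by (auto simp: D_def)
  next
    case Down
    then obtain x y z where xs_eq: "xs = [x, y, z]"
      using len by (auto simp: numeral_eq_Suc length_Suc_conv)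
    have "down' (Some x) {Some y, Some z} \<longleftrightarrow> down x {y, z}"
      by (auto simp: down'_def doubleton_eq_iff)
    then show ?thesis
      using Down xs xs_eq down_iff[of x y z]
      by (auto simp: D_def)
  qed
  have e_int: "interp M r xs \<longleftrightarrow> interp M r (map e xs)"
    if "length xs = arity r" "set xs \<subseteq> ?X" for r xs
  proof -
    have "set (map Some xs) \<subseteq> {Some a, Some b, Some c, None}" using that(2) by auto
    then show ?thesis
      using D_int[OF that] h_int[of "map Some xs" r] that(1) by (simp add: e_def comp_def)
  qed
  \<comment> \<open>This map sends the copy of \<open>{a, b, c}\<close> inside the image of
    \<open>h\<close> back to the original points; its extension \<open>g\<close> carries
    \<open>h None\<close> to the required witness.\<close>
  let ?f = "inv_into ?X e"
  have "embedding ?f (Fo_struct (e ` ?X) (interp M)) M"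
    unfolding embedding_def fo_struct.sel
  proof (intro conjI allI impI)
    show "?f ` (e ` ?X) \<subseteq> universe M" unfolding inv_into_image_cancel[OF e_inj order_refl] by (rule X(2))
    show "inj_on ?f (e ` ?X)" by (rule inj_on_inv_into) simp
    fix r :: L_plus and xs assume xs: "length xs = arity r \<and> set xs \<subseteq> e ` ?X"
    have "set (map ?f xs) \<subseteq> ?X" using xs by (auto simp only: set_map intro!: inv_into_into)
    moreover have "map e (map ?f xs) = xs"
      unfolding map_map by (rule map_idI) (metis comp_apply f_inv_into_f subsetD xs)
    ultimately show "interp M r xs = interp M r (map ?f xs)"
      using e_int[of "map ?f xs" r] xs by simp
  qed
  then obtain g where g: "automorphism g M" and gf: "\<forall>x\<in>e ` ?X. g x = ?f x"
    using M e_im unfolding fraisse_limit_def ultrahomogeneous_def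
    by (metis finite.emptyI finite_imageI finite_insert)
  have ge: "g (e x) = x" if "x \<in> ?X" for x
    using inv_into_f_f[OF e_inj that] gf[rule_format, OF imageI[OF that]] by simp
  then have gh: "g (h (Some a)) = a" "g (h (Some b)) = b" "g (h (Some c)) = c"
    by (simp_all add: e_def)
  let ?d = "g (h None)"
  have g_int: "interp M r xs \<longleftrightarrow> interp M r (map g xs)"
    if "length xs = arity r" "set xs \<subseteq> universe M" for r xs
    using g that by (simp add: automorphism_def embedding_def)
  have int: "interp D r xs \<longleftrightarrow> interp M r (map (g \<circ> h) xs)"
    if "length xs = arity r" "set xs \<subseteq> {Some a, Some b, Some c, None}" for r xs
  proof -
    have "set (map h xs) \<subseteq> universe M" using h_im that(2) by auto
    then show ?thesis using h_int[OF that] g_int[of "map h xs" r] that(1) by simp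
  qed
  have "?d \<in> universe M" using g h_im by (auto simp: automorphism_def embedding_def)
  moreover have "if interp M Down [a, b, c] then interp M (Base Less) [b, c, a, ?d]
     else interp M (Base Less) [a, ?d, b, c]"
  proof (cases "down a {b, c}")
    case True
    then have "interp D (Base Less) [Some b, Some c, Some a, None]"
      using ne by (simp add: D_def lt'_def)
    then have "interp M (Base Less) [b, c, a, ?d]"
      using int[of "[Some b, Some c, Some a, None]" "Base Less"] gh by simp
    then show ?thesis using down_iff[of a b c] True ne by simp
  next
    case False
    then have "interp D (Base Less) [Some a, None, Some b, Some c]"
      using ne by (simp add: D_def lt'_def)
    then have "interp M (Base Less) [a, ?d, b, c]"
      using int[of "[Some a, None, Some b, Some c]" "Base Less"] gh by simp
    then show ?thesis using down_iff[of a b c] False ne by simp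
  qed
  ultimately show thesis by (rule that)
qed

text \<open>The first two clauses define the labels existentially. The last two say that, apart from
  coincidences among the points, each label is the negation of the other, which makes the negations
  existential as well.\<close>

lemma fraisse_limit_labels_existential:
  assumes M: "fraisse_limit finite_labeled_switchboards M"
    and U: "a \<in> universe M" "b \<in> universe M" "c \<in> universe M"
  shows "interp M Down [a, b, c] \<longleftrightarrow> b \<noteq> c \<and> (\<exists>d\<in>universe M. interp M (Base Less) [b, c, a, d])"
    and "interp M Up [a, b, c] \<longleftrightarrow> b \<noteq> c \<and> (\<exists>d\<in>universe M. interp M (Base Less) [a, d, b, c])"
    and "interp M Up [a, b, c] \<longleftrightarrow> b \<noteq> c \<and> a \<noteq> b \<and> a \<noteq> c \<and> \<not> interp M Down [a, b, c]"
    and "interp M Down [a, b, c] \<Longrightarrow> b \<noteq> c \<and> a \<noteq> b \<and> a \<noteq> c"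
proof -
  have local: "(interp M Up [a, b, c] \<longleftrightarrow> b \<noteq> c \<and> a \<noteq> b \<and> a \<noteq> c \<and> \<not> interp M Down [a, b, c]) \<and>
      (interp M Down [a, b, c] \<longrightarrow> b \<noteq> c \<and> a \<noteq> b \<and> a \<noteq> c) \<and>
      (b \<noteq> c \<and> interp M (Base Less) [b, c, a, d] \<longrightarrow> interp M Down [a, b, c]) \<and>
      (b \<noteq> c \<and> interp M (Base Less) [a, d, b, c] \<longrightarrow> interp M Up [a, b, c])"
    if d: "d \<in> universe M" for d
  proof -
    let ?X = "{a, b, c, d}"
    have X: "finite ?X" "?X \<subseteq> universe M" using U d by simp_all
    obtain lt up down where L: "labeled_switchboard ?X lt up down"
      and less: "\<And>x y z w. \<lbrakk>x \<in> ?X; y \<in> ?X; z \<in> ?X; w \<in> ?X\<rbrakk> \<Longrightarrow>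
        interp M (Base Less) [x, y, z, w] \<longleftrightarrow> x \<noteq> y \<and> z \<noteq> w \<and> lt {x, y} {z, w}"
      and up_iff: "\<And>a b c. \<lbrakk>a \<in> ?X; b \<in> ?X; c \<in> ?X\<rbrakk> \<Longrightarrow> interp M Up [a, b, c] \<longleftrightarrow> b \<noteq> c \<and> up a {b, c}"
      and down_iff: "\<And>a b c. \<lbrakk>a \<in> ?X; b \<in> ?X; c \<in> ?X\<rbrakk> \<Longrightarrow>
        interp M Down [a, b, c] \<longleftrightarrow> b \<noteq> c \<and> down a {b, c}"
      using fraisse_limit_labels[OF M X] by blast
    have tri: "b \<noteq> c \<Longrightarrow> up a {b, c} \<longleftrightarrow> a \<notin> {b, c} \<and> \<not> down a {b, c}"
      "b \<noteq> c \<Longrightarrow> a \<in> {b, c} \<Longrightarrow> \<not> down a {b, c}"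
      using labeled_switchboardD(2,3)[OF L, of a "{b, c}"] by simp_all
    show ?thesis
      using tri up_iff[of a b c] down_iff[of a b c] less[of b c a d] less[of a d b c]
        labeled_switchboard_down(2)[OF L, of a b c d] labeled_switchboard_up[OF L, of a b c d]
      by auto
  qed
  \<comment> \<open>These two conjuncts of \<open>local\<close> do not mention \<open>d\<close>, so
    \<open>a\<close> itself is taken for it.\<close>
  note facts = local[OF U(1), THEN conjunct1] local[OF U(1), THEN conjunct2, THEN conjunct1]
  show 3: "interp M Up [a, b, c] \<longleftrightarrow> b \<noteq> c \<and> a \<noteq> b \<and> a \<noteq> c \<and> \<not> interp M Down [a, b, c]"
    and 4: "interp M Down [a, b, c] \<Longrightarrow> b \<noteq> c \<and> a \<noteq> b \<and> a \<noteq> c"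
    using facts by blast+
  show "interp M Down [a, b, c] \<longleftrightarrow> b \<noteq> c \<and> (\<exists>d\<in>universe M. interp M (Base Less) [b, c, a, d])"
  proof
    assume D: "interp M Down [a, b, c]"
    then have "a \<noteq> b" "a \<noteq> c" "b \<noteq> c" using 4 by blast+
    from fraisse_limit_witness[OF M U this] D
    show "b \<noteq> c \<and> (\<exists>d\<in>universe M. interp M (Base Less) [b, c, a, d])"
      using \<open>b \<noteq> c\<close> by metis
  qed (use local in blast)
  show "interp M Up [a, b, c] \<longleftrightarrow> b \<noteq> c \<and> (\<exists>d\<in>universe M. interp M (Base Less) [a, d, b, c])"
  proof
    assume "interp M Up [a, b, c]"
    then have ne: "a \<noteq> b" "a \<noteq> c" "b \<noteq> c" and D: "\<not> interp M Down [a, b, c]" using 3 by blast+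
    from fraisse_limit_witness[OF M U ne] D
    show "b \<noteq> c \<and> (\<exists>d\<in>universe M. interp M (Base Less) [a, d, b, c])"
      using \<open>b \<noteq> c\<close> by metis
  qed (use local in blast)
qed

section \<open>The theory of the reduct\<close>

lemma finite_UNIV_L_plus: "finite (UNIV :: L_plus set)"
proof -
  have "r \<in> {Base Less, Up, Down}" for r
    by (cases r) (use L_minus.exhaust in auto)
  then have "(UNIV :: L_plus set) = {Base Less, Up, Down}" by blast
  then show ?thesis by (metis finite.emptyI finite_insert)
qed

lemma length_3E:
  assumes "length xs = 3"
  obtains x y z where "xs = [x, y, z]"
  using assms by (auto simp: numeral_eq_Suc length_Suc_conv)

lemma existentially_definable_atom:
  fixes M :: "(L_plus, 'a) fo_struct"
  assumes M: "fraisse_limit finite_labeled_switchboards M" and \<theta>: "\<theta> \<in> atoms V"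
  shows "existentially_definable (reduct M) (\<lambda>v. sat M v \<theta>)"
    and "existentially_definable (reduct M) (\<lambda>v. \<not> sat M v \<theta>)"
proof -
  let ?N = "reduct M"
  note D = fraisse_limit_labels_existential[OF M]
  have ex: "existentially_definable ?N P" if "existential \<psi>"
    "\<And>v. range v \<subseteq> universe M \<Longrightarrow> sat ?N v \<psi> = P v" for P \<psi>
    using that unfolding existentially_definable_def by auto
  \<comment> \<open>These are the triples that carry no label; they complement \<open>Up\<close> and
    \<open>Down\<close>.\<close>
  have neq: "existentially_definable ?N (\<lambda>v. v j = v k \<or> v i = v j \<or> v i = v k)" for i j k
    by (rule ex[of "Disj (Eq j k) (Disj (Eq i j) (Eq i k))"]) (auto intro: existential.intros)
  have vU: "v n \<in> universe M" if "range v \<subseteq> universe M" for v n using that by auto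
  \<comment> \<open>\<open>Suc (i + j + k)\<close> exceeds \<open>i\<close>, \<open>j\<close> and
    \<open>k\<close>, so binding it captures none of them.\<close>
  have down: "existentially_definable ?N (\<lambda>v. interp M Down [v i, v j, v k])" for i j k
    by (rule ex[of "Conj (Neg (Eq j k)) (Exists (Suc (i + j + k)) (Rel Less [j, k, i, Suc (i + j + k)]))"])
      (auto simp: D(1) vU intro!: existential.intros)
  have up: "existentially_definable ?N (\<lambda>v. interp M Up [v i, v j, v k])" for i j k
    by (rule ex[of "Conj (Neg (Eq j k)) (Exists (Suc (i + j + k)) (Rel Less [i, Suc (i + j + k), j, k]))"])
      (auto simp: D(2) vU intro!: existential.intros)
  have not_down: "existentially_definable ?N (\<lambda>v. \<not> interp M Down [v i, v j, v k])" for i j k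
  proof (rule existentially_definable_cong[OF existentially_definable_disj[OF neq up[of i j k]]])
    fix v :: "nat \<Rightarrow> 'a" assume "range v \<subseteq> universe ?N"
    then have v: "range v \<subseteq> universe M" by simp
    show "((v j = v k \<or> v i = v j \<or> v i = v k) \<or> interp M Up [v i, v j, v k]) =
        (\<not> interp M Down [v i, v j, v k])"
      using D(3)[OF vU[OF v, of i] vU[OF v, of j] vU[OF v, of k]]
        D(4)[OF vU[OF v, of i] vU[OF v, of j] vU[OF v, of k]] by blast
  qed
  have not_up: "existentially_definable ?N (\<lambda>v. \<not> interp M Up [v i, v j, v k])" for i j k
  proof (rule existentially_definable_cong[OF existentially_definable_disj[OF neq down[of i j k]]])
    fix v :: "nat \<Rightarrow> 'a" assume "range v \<subseteq> universe ?N"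
    then have v: "range v \<subseteq> universe M" by simp
    show "((v j = v k \<or> v i = v j \<or> v i = v k) \<or> interp M Down [v i, v j, v k]) =
        (\<not> interp M Up [v i, v j, v k])"
      using D(3)[OF vU[OF v, of i] vU[OF v, of j] vU[OF v, of k]] by blast
  qed
  consider m n where "\<theta> = Eq m n" | r ns where "\<theta> = Rel r ns" "length ns = arity r"
    using \<theta> by (auto simp: atoms_def)
  then have "existentially_definable ?N (\<lambda>v. sat M v \<theta>) \<and>
      existentially_definable ?N (\<lambda>v. \<not> sat M v \<theta>)"
  proof cases
    case 1
    then show ?thesis
      by (auto intro: ex[of "Eq m n"] ex[of "Neg (Eq m n)"] existential.intros)
  next
    case 2
    show ?thesis
    proof (cases r)
      case (Base s)
      with 2 show ?thesis
        by (auto intro: ex[of "Rel s ns"] ex[of "Neg (Rel s ns)"] existential.intros)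
    next
      case Up
      with 2 obtain i j k where "ns = [i, j, k]" by (auto elim: length_3E)
      with 2 Up up[of i j k] not_up[of i j k] show ?thesis by simp
    next
      case Down
      with 2 obtain i j k where "ns = [i, j, k]" by (auto elim: length_3E)
      with 2 Down down[of i j k] not_down[of i j k] show ?thesis by simp
    qed
  qed
  then show "existentially_definable ?N (\<lambda>v. sat M v \<theta>)"
    and "existentially_definable ?N (\<lambda>v. \<not> sat M v \<theta>)" by blast+
qed

lemma existentially_definable_formula:
  fixes M :: "(L_plus, 'a) fo_struct"
  assumes M: "fraisse_limit finite_labeled_switchboards M" and \<phi>: "well_formed \<phi>"
  shows "existentially_definable (reduct M) (\<lambda>v. sat (reduct M) v \<phi>)"
proof (rule existentially_definable_finite_types)
  let ?I = "atoms (free_vars (map_fm Base \<phi>)) :: L_plus fm set"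
  show "finite ?I" by (intro finite_atoms finite_free_vars finite_UNIV_L_plus)
  show "existentially_definable (reduct M) (\<lambda>v. sat M v \<theta>)"
    "existentially_definable (reduct M) (\<lambda>v. \<not> sat M v \<theta>)" if "\<theta> \<in> ?I" for \<theta>
    using existentially_definable_atom[OF M that] .
  fix v w :: "nat \<Rightarrow> 'a"
  assume v: "range v \<subseteq> universe (reduct M)" and w: "range w \<subseteq> universe (reduct M)"
    and eq: "\<And>\<theta>. \<theta> \<in> ?I \<Longrightarrow> sat M v \<theta> = sat M w \<theta>"
  have "ultrahomogeneous M" using M by (simp add: fraisse_limit_def)
  moreover have "well_formed (map_fm Base \<phi>)" using \<phi> by (simp add: well_formed_map_fm_Base)
  ultimately have "sat M v (map_fm Base \<phi>) = sat M w (map_fm Base \<phi>)"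
    by (rule ultrahomogeneous_sat_cong[OF _ _ v[unfolded fo_struct.sel] w[unfolded fo_struct.sel] eq])
  then show "sat (reduct M) v \<phi> = sat (reduct M) w \<phi>" by (simp only: sat_map_fm_Base)
qed

section \<open>Universal axioms and the embedding of finite switchboards\<close>

primrec quantifier_free :: "'r fm \<Rightarrow> bool" where
  "quantifier_free (Eq m n) \<longleftrightarrow> True"
| "quantifier_free (Rel r ns) \<longleftrightarrow> True"
| "quantifier_free (Neg \<phi>) \<longleftrightarrow> quantifier_free \<phi>"
| "quantifier_free (Conj \<phi> \<psi>) \<longleftrightarrow> quantifier_free \<phi> \<and> quantifier_free \<psi>"
| "quantifier_free (Exists n \<phi>) \<longleftrightarrow> False"

lemma sat_quantifier_free_substructure:
  "quantifier_free \<phi> \<Longrightarrow> sat (Fo_struct X (interp M)) v \<phi> \<longleftrightarrow> sat M v \<phi>"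
  by (induction \<phi>) auto

text \<open>A counterexample to a universal formula involves finitely many points. In this way the
  switchboard axioms reach the reduct of \<open>M\<close>, of which only the finite substructures
  are under control.\<close>

lemma universal_holds_if_finite_substructures:
  fixes M :: "('r::language, 'a) fo_struct"
  assumes qf: "quantifier_free \<chi>"
    and fin: "\<And>X. finite X \<Longrightarrow> X \<subseteq> universe M \<Longrightarrow> X \<noteq> {} \<Longrightarrow>
      Fo_struct X (interp M) \<Turnstile> foldr Forall xs \<chi>"
  shows "M \<Turnstile> foldr Forall xs \<chi>"
proof (unfold holds_foldr_Forall, unfold holds_def, intro allI impI)
  fix v :: "nat \<Rightarrow> 'a" assume v: "range v \<subseteq> universe M"
  \<comment> \<open>Variables not free in \<open>\<chi>\<close> are reset to \<open>v 0\<close>, so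
    that \<open>w\<close> takes values in the finite set \<open>?X\<close>; containing
    \<open>v 0\<close>, this set is nonempty even when \<open>\<chi>\<close> has no free
    variables.\<close>
  define w where "w n = (if n \<in> free_vars \<chi> then v n else v 0)" for n
  let ?X = "v ` insert 0 (free_vars \<chi>)"
  have "Fo_struct ?X (interp M) \<Turnstile> \<chi>"
    using fin[of ?X] v finite_free_vars[of \<chi>] unfolding holds_foldr_Forall by blast
  moreover have "range w \<subseteq> ?X" by (auto simp: w_def)
  ultimately have "sat (Fo_struct ?X (interp M)) w \<chi>" by (simp add: holds_def)
  then have "sat M w \<chi>" by (simp only: sat_quantifier_free_substructure[OF qf])
  moreover have "sat M w \<chi> \<longleftrightarrow> sat M v \<chi>" by (rule sat_cong) (simp add: w_def)
  ultimately show "sat M v \<chi>" by simp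
qed

lemma switchboard_theory_universal:
  assumes "\<phi> \<in> switchboard_theory"
  obtains xs \<chi> where "quantifier_free \<chi>" "\<phi> = foldr Forall xs \<chi>"
proof -
  have split: "\<exists>xs \<chi>. quantifier_free \<chi> \<and> \<phi> = foldr Forall xs \<chi>"
    if "\<phi> \<in> {foldr Forall xs1 \<chi>1, foldr Forall xs2 \<chi>2, foldr Forall xs3 \<chi>3, foldr Forall xs4 \<chi>4}"
      "quantifier_free \<chi>1" "quantifier_free \<chi>2" "quantifier_free \<chi>3" "quantifier_free \<chi>4"
    for xs1 xs2 xs3 xs4 and \<chi>1 \<chi>2 \<chi>3 \<chi>4 :: "L_minus fm"
    using that by blast
  have "\<exists>xs \<chi>. quantifier_free \<chi> \<and> \<phi> = foldr Forall xs \<chi>"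
    \<comment> \<open>The lists are the quantifier prefixes of the four axioms, in the order of
      their definition.\<close>
    by (rule split[of "[0, 1, 2, 3]" _ "[0, 1]" _ "[0, 1, 2, 3, 4, 5]" _ "[0, 1, 2]"])
      (use assms in \<open>simp only: switchboard_theory_def Let_def foldr.simps comp_def id_def\<close>, simp_all)
  then show thesis using that by blast
qed

lemma switchboard_struct_reduct:
  assumes "labeled_switchboard_struct A"
  shows "switchboard_struct (reduct A)"
  using assms
  unfolding labeled_switchboard_struct_def switchboard_struct_def labeled_switchboard_def fo_struct.sel
  by (elim exE conjE) (intro exI conjI)

lemma switchboard_theory_subset:
  assumes M: "fraisse_limit finite_labeled_switchboards M"
  shows "switchboard_theory \<subseteq> complete_theory (reduct M)"
proof
  fix \<phi> assume \<phi>: "\<phi> \<in> switchboard_theory"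
  then obtain xs \<chi> where qf: "quantifier_free \<chi>" and eq: "\<phi> = foldr Forall xs \<chi>"
    by (rule switchboard_theory_universal)
  have "reduct M \<Turnstile> \<phi>"
    unfolding eq
  proof (rule universal_holds_if_finite_substructures[OF qf])
    fix X assume X: "finite X" "X \<subseteq> universe (reduct M)" "X \<noteq> {}"
    let ?X = "Fo_struct X (interp (reduct M))"
    have "switchboard_struct ?X"
      using switchboard_struct_reduct[OF fraisse_limit_finite_substructure[OF M, of X]] X by simp
    then have "is_model ?X switchboard_theory"
      using X(3) by (simp add: is_model_switchboard_theory_iff)
    then show "?X \<Turnstile> foldr Forall xs \<chi>" using \<phi> unfolding is_model_def eq by blast
  qed
  then show "\<phi> \<in> complete_theory (reduct M)"
    using sentence_switchboard_theory[OF \<phi>] by (simp add: complete_theory_def)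
qed

text \<open>A labeling of all of \<open>A\<close> restricts to \<open>X\<close>; the labeled
  structure on \<open>X\<close> embeds into \<open>M\<close> by the age, and forgetting the labels
  leaves an embedding into the reduct.\<close>

lemma finite_switchboard_embeds:
  assumes M: "fraisse_limit finite_labeled_switchboards M"
    and A: "switchboard_struct A" and X: "finite X" "X \<subseteq> universe A"
  shows "\<exists>f. embedding f (Fo_struct X (interp A)) (reduct M)"
proof -
  let ?U = "universe A"
  obtain lt where sb: "switchboard ?U lt" and less: "\<forall>x\<in>?U. \<forall>y\<in>?U. \<forall>z\<in>?U. \<forall>w\<in>?U.
      interp A Less [x, y, z, w] \<longleftrightarrow> x \<noteq> y \<and> z \<noteq> w \<and> lt {x, y} {z, w}"
    using A unfolding switchboard_struct_def by (elim exE conjE)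
  obtain up down where L: "labeled_switchboard ?U lt up down"
    using sb by (rule switchboard_labeling)
  let ?L = "labeled_struct ?U lt up down"
  have sub: "embedding (\<lambda>x. x) (Fo_struct X (interp ?L)) ?L"
    using X(2) by (intro embedding_substructure) simp
  have "labeled_switchboard_struct (Fo_struct X (interp ?L))"
    by (rule labeled_switchboard_struct_embedding[OF sub labeled_switchboard_struct_labeled_struct[OF L]])
  then obtain f where f: "embedding f (Fo_struct X (interp ?L)) M"
    using fraisse_limit_embeds[OF M, of "Fo_struct X (interp ?L)"] X(1) by auto
  have "interp A r xs \<longleftrightarrow> interp M (Base r) (map f xs)"
    if xs: "length xs = arity r" "set xs \<subseteq> X" for r xs
  proof -
    have "r = Less" by (cases r)
    then obtain x y z w where xs_eq: "xs = [x, y, z, w]"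
      using xs(1) by (auto simp: numeral_eq_Suc length_Suc_conv)
    have "interp A r xs \<longleftrightarrow> interp ?L (Base r) xs"
      using less[rule_format, of x y z w] xs(2) X(2) \<open>r = Less\<close> by (auto simp: xs_eq)
    also have "\<dots> \<longleftrightarrow> interp M (Base r) (map f xs)"
      using f xs by (simp add: embedding_def)
    finally show ?thesis .
  qed
  then show ?thesis using f by (intro exI[of _ f]) (simp add: embedding_def)
qed

theorem theorem4p19:
  fixes M :: "(L_plus, 'a) fo_struct"
    and T_plus :: "L_plus fm set"
    and T_minus :: "L_minus fm set"
  assumes "fraisse_limit finite_labeled_switchboards M"
    and "T_plus = complete_theory M"
    and "T_minus = reduct_to_L_minus T_plus"
    and "infinite (UNIV :: 'u set)"
  shows "model_companion TYPE('u) T_minus switchboard_theory"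
proof -
  note M = assms(1)
  have T: "T_minus = complete_theory (reduct M)"
    using assms(2,3) by (simp add: reduct_complete_theory)
  have "models_embed TYPE('u) switchboard_theory T_minus"
    unfolding models_embed_def T
  proof (intro allI impI)
    fix A :: "(L_minus, 'u) fo_struct" assume "is_model A switchboard_theory"
    then have "universe A \<noteq> {}" "switchboard_struct A"
      by (simp_all add: is_model_switchboard_theory_iff)
    then show "\<exists>(B :: (L_minus, 'u) fo_struct) f. is_model B (complete_theory (reduct M)) \<and> embedding f A B"
      using finite_switchboard_embeds[OF M]
      by (intro embeds_in_model_if_finite_subsets_embed assms(4)) blast+
  qed
  \<comment> \<open>Models of \<open>T_minus\<close> are themselves switchboards, so the identity
    embedding serves.\<close>
  moreover have "models_embed TYPE('u) T_minus switchboard_theory"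
    unfolding models_embed_def
  proof (intro allI impI)
    fix A :: "(L_minus, 'u) fo_struct" assume "is_model A T_minus"
    then have "is_model A switchboard_theory"
      using switchboard_theory_subset[OF M] unfolding T is_model_def by blast
    moreover have "embedding (\<lambda>x. x) A A" by (simp add: embedding_def)
    ultimately show "\<exists>(B :: (L_minus, 'u) fo_struct) f. is_model B switchboard_theory \<and> embedding f A B"
      by blast
  qed
  moreover have "model_complete TYPE('u) T_minus"
    unfolding T using existentially_definable_formula[OF M]
    by (intro model_complete_complete_theory) (simp add: existentially_definable_def)
  ultimately show ?thesis by (simp add: model_companion_def)
qed

end
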